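(* Let $H$ be a Sidorenko graph and let $e=(u,v)$ be any edge of $H$. Then $e$ is smooth in $H$; that is, labeling $u$ by $1$ and $v$ by $2$, so that $H\in\mathcal{G}_2$ and the subgraph spanned by the labeled vertices is the tree $T$ consisting of the single edge $e$, we have for every bounded symmetric measurable $W:[0,1]^2\to(0,\infty)$ $$\int_{[0,1]^2} \frac{W(x_1,x_2)}{d}\,\ln t_{\{x_1,x_2\}}(H^*,W)(x_1,x_2)\,dx_1\,dx_2\;\geq\; |E(H^* )|\ln d,$$ where $H^*$ is $H$ with the edge $e$ deleted (keeping the labels) and $d=\int_{[0,1]^2}W$.
   Context: A graphon is a symmetric measurable $W:[0,1]^2\to[0,1]$; for a finite graph $H$ on $x_1,\dots,x_m$, $t(H,W)=\int\prod_{(x_i,x_j)\in E(H)}W(x_i,x_j)\,dx_1\cdots dx_m$. A bipartite graph $H$ with $e$ edges is Sidorenko if $t(H,W)\geq(\int W)^e$ for every graphon $W$. $\mathcal{G}_n$ is the set of graphs in which $n$ distinct vertices are labeled $1,\dots,n$. For $H\in\mathcal{G}_n$ on vertex set $\{x_1,\dots,x_m\}$ with labeled vertices $S=\{x_1,\dots,x_n\}$, the restricted density $t_S(H,W)$ is the function of $x_1,\dots,x_n$ given by $\int\prod_{(x_i,x_j)\in E(H)}W(x_i,x_j)\,dx_{n+1}\cdots dx_m$. *)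

theory Defs
  imports "HOL-Analysis.Analysis"
begin

text \<open>Finite simple graphs are given by a vertex set and a set of two-element edges.\<close>

definition simple_graph :: "'a set \<Rightarrow> 'a set set \<Rightarrow> bool" where
  "simple_graph V E \<longleftrightarrow> finite V \<and> (\<forall>e\<in>E. e \<subseteq> V \<and> card e = 2)"

definition bipartite :: "'a set \<Rightarrow> 'a set set \<Rightarrow> bool" where
  "bipartite V E \<longleftrightarrow>
     (\<exists>A B. A \<union> B = V \<and> A \<inter> B = {} \<and> (\<forall>e\<in>E. \<exists>a\<in>A. \<exists>b\<in>B. e = {a, b}))"

text \<open>Only the values of \<open>W\<close> on the unit square are relevant. Measurability means Lebesgue
  measurability, so sections of \<open>W\<close> are only almost everywhere measurable; accordingly all
  integrals below are taken with respect to complete measures.\<close>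

definition symmetric_measurable :: "(real \<Rightarrow> real \<Rightarrow> real) \<Rightarrow> bool" where
  "symmetric_measurable W \<longleftrightarrow>
     (\<lambda>(x, y). W x y) \<in> borel_measurable (lebesgue_on ({0..1} \<times> {0..1})) \<and>
     (\<forall>x\<in>{0..1}. \<forall>y\<in>{0..1}. W x y = W y x)"

definition graphon :: "(real \<Rightarrow> real \<Rightarrow> real) \<Rightarrow> bool" where
  "graphon W \<longleftrightarrow> symmetric_measurable W \<and> (\<forall>x\<in>{0..1}. \<forall>y\<in>{0..1}. W x y \<in> {0..1})"

definition bounded_positive_kernel :: "(real \<Rightarrow> real \<Rightarrow> real) \<Rightarrow> bool" where
  "bounded_positive_kernel W \<longleftrightarrow> symmetric_measurable W \<and>
     (\<exists>C. \<forall>x\<in>{0..1}. \<forall>y\<in>{0..1}. 0 < W x y \<and> W x y \<le> C)"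

definition edge_density :: "(real \<Rightarrow> real \<Rightarrow> real) \<Rightarrow> real" where
  "edge_density W = (\<integral>(x, y). W x y \<partial>lebesgue_on ({0..1} \<times> {0..1}))"

text \<open>The Lebesgue measure on the cube of all maps from \<open>V\<close> to the unit interval.\<close>

definition cube_measure :: "'a set \<Rightarrow> ('a \<Rightarrow> real) measure" where
  "cube_measure V = completion (\<Pi>\<^sub>M i\<in>V. restrict_space lborel {0..1})"

text \<open>The value \<open>W (x i) (x j)\<close> for the unordered edge \<open>{i, j}\<close>; it is well defined whenever
  \<open>W\<close> is symmetric on the unit square and \<open>x i\<close>, \<open>x j\<close> lie in the unit interval.\<close>

definition edge_weight :: "(real \<Rightarrow> real \<Rightarrow> real) \<Rightarrow> ('a \<Rightarrow> real) \<Rightarrow> 'a set \<Rightarrow> real" where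
  "edge_weight W x e = (THE r. \<exists>i j. e = {i, j} \<and> r = W (x i) (x j))"

definition hom_density :: "'a set \<Rightarrow> 'a set set \<Rightarrow> (real \<Rightarrow> real \<Rightarrow> real) \<Rightarrow> real" where
  "hom_density V E W = (\<integral>x. (\<Prod>e\<in>E. edge_weight W x e) \<partial>cube_measure V)"

text \<open>The labeled vertices \<open>S\<close> carry the fixed coordinates \<open>x\<close>; the coordinates of the
  remaining vertices are integrated out.\<close>

definition restricted_density ::
  "'a set \<Rightarrow> 'a set set \<Rightarrow> 'a set \<Rightarrow> (real \<Rightarrow> real \<Rightarrow> real) \<Rightarrow> ('a \<Rightarrow> real) \<Rightarrow> real" where
  "restricted_density V E S W x =
     (\<integral>y. (\<Prod>e\<in>E. edge_weight W (merge S (V - S) (x, y)) e) \<partial>cube_measure (V - S))"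

definition sidorenko :: "'a set \<Rightarrow> 'a set set \<Rightarrow> bool" where
  "sidorenko V E \<longleftrightarrow> simple_graph V E \<and> bipartite V E \<and>
     (\<forall>W. graphon W \<longrightarrow> hom_density V E W \<ge> edge_density W ^ card E)"

text \<open>The integrand below is bounded above almost everywhere, so its integral always exists in
  \<open>[-\<infinity>, \<infinity>)\<close>, and a lower bound by a real number includes that it is finite. As the
  Bochner integral of a non-integrable function is 0, integrability is stated explicitly.\<close>

definition smooth_edge :: "'a set \<Rightarrow> 'a set set \<Rightarrow> 'a \<Rightarrow> 'a \<Rightarrow> bool" where
  "smooth_edge V E u v \<longleftrightarrow>
     (\<forall>W. bounded_positive_kernel W \<longrightarrow>
       (let d = edge_density W;
            E' = E - {{u, v}};
            f = (\<lambda>(x1, x2). W x1 x2 / d *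
                   ln (restricted_density V E' {u, v} W (\<lambda>w. if w = u then x1 else x2)))
        in integrable (lebesgue_on ({0..1} \<times> {0..1})) f \<and>
           integral\<^sup>L (lebesgue_on ({0..1} \<times> {0..1})) f \<ge> real (card E') * ln d))"

end

theory Submission
  imports Defs "HOL-Probability.Probability"
begin

text \<open>For a positive step kernel the inequality is an entropy argument. Let \<open>T\<close> be the restricted
  density of \<open>H\<close> without the edge \<open>e\<close>, and let \<open>\<mu>\<close> be the mean of \<open>ln T\<close> under the probability density \<open>W / d\<close>.
  Take the \<open>N\<close>-th tensor power of \<open>W\<close> and set it to zero outside the pairs at which the average of
  \<open>ln T\<close> over the \<open>N\<close> coordinates is at most \<open>\<mu> + \<delta>\<close>, in both orders of the pair. By the law of large numbers
  this keeps almost all of the edge density \<open>d ^ N\<close>, whereas the density of \<open>H\<close> becomes at most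
  \<open>d ^ N * exp (N * (\<mu> + \<delta>))\<close>. The Sidorenko inequality for the truncated kernel, after taking \<open>N\<close>-th roots,
  gives \<open>\<mu> + \<delta> \<ge> (|E(H)| - 1) * ln d\<close>. Step kernels keep the tensor power a step kernel on the
  unit interval. A general kernel is an almost everywhere limit of continuous kernels, these are limits
  of step kernels, and the inequality survives the limits by Fatou's lemma, since \<open>ln T\<close> is bounded above.\<close>

section \<open>Finite kernels and tensor powers\<close>

text \<open>Distributivity in each argument in turn: the total mass of a tensor power of
  \<open>f\<close> is the power of its total mass. This gives both the normalisation of the tensor
  power and the Chernoff bound for it.\<close>

lemma sum_PiE_pair_prod:
  fixes f :: "'b \<Rightarrow> 'b \<Rightarrow> real"
  assumes "finite I" "finite K"
  shows "(\<Sum>\<alpha>\<in>I \<rightarrow>\<^sub>E K. \<Sum>\<beta>\<in>I \<rightarrow>\<^sub>E K. \<Prod>i\<in>I. f (\<alpha> i) (\<beta> i)) = (\<Sum>a\<in>K. \<Sum>b\<in>K. f a b) ^ card I"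
proof -
  have "(\<Sum>a\<in>K. \<Sum>b\<in>K. f a b) ^ card I = (\<Prod>i\<in>I. \<Sum>a\<in>K. \<Sum>b\<in>K. f a b)"
    by simp
  also have "\<dots> = (\<Sum>\<alpha>\<in>I \<rightarrow>\<^sub>E K. \<Prod>i\<in>I. \<Sum>b\<in>K. f (\<alpha> i) b)"
    using assms by (intro prod_sum_PiE) auto
  also have "\<dots> = (\<Sum>\<alpha>\<in>I \<rightarrow>\<^sub>E K. \<Sum>\<beta>\<in>I \<rightarrow>\<^sub>E K. \<Prod>i\<in>I. f (\<alpha> i) (\<beta> i))"
    using assms by (intro sum.cong refl prod_sum_PiE) auto
  finally show ?thesis by simp
qed

text \<open>A map from \<open>V\<close> to \<open>I\<close>-tuples is the same as an
  \<open>I\<close>-tuple of maps on \<open>V\<close>, so homomorphism sums are multiplicative under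
  tensor powers of the kernel.\<close>

lemma sum_PiE_flip_prod:
  fixes f :: "('a \<Rightarrow> 'b) \<Rightarrow> real"
  assumes "finite V" "finite I" "finite K"
  shows "(\<Sum>z\<in>V \<rightarrow>\<^sub>E (I \<rightarrow>\<^sub>E K). \<Prod>i\<in>I. f (\<lambda>w\<in>V. z w i)) = (\<Sum>\<zeta>\<in>V \<rightarrow>\<^sub>E K. f \<zeta>) ^ card I"
proof -
  have "(\<Sum>\<zeta>\<in>V \<rightarrow>\<^sub>E K. f \<zeta>) ^ card I = (\<Prod>i\<in>I. \<Sum>\<zeta>\<in>V \<rightarrow>\<^sub>E K. f \<zeta>)"
    by simp
  also have "\<dots> = (\<Sum>\<xi>\<in>I \<rightarrow>\<^sub>E (V \<rightarrow>\<^sub>E K). \<Prod>i\<in>I. f (\<xi> i))"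
    using assms by (intro prod_sum_PiE) (auto intro: finite_PiE)
  also have "\<dots> = (\<Sum>z\<in>V \<rightarrow>\<^sub>E (I \<rightarrow>\<^sub>E K). \<Prod>i\<in>I. f (\<lambda>w\<in>V. z w i))"
  proof (rule sum.reindex_bij_witness[of _ "\<lambda>z. \<lambda>i\<in>I. \<lambda>w\<in>V. z w i" "\<lambda>\<xi>. \<lambda>w\<in>V. \<lambda>i\<in>I. \<xi> i w"])
    fix \<xi> assume \<xi>: "\<xi> \<in> I \<rightarrow>\<^sub>E (V \<rightarrow>\<^sub>E K)"
    have 1: "(\<lambda>w\<in>V. (\<lambda>w\<in>V. \<lambda>i\<in>I. \<xi> i w) w i) = \<xi> i" if "i \<in> I" for i
      using \<xi> that by (auto simp: fun_eq_iff PiE_iff extensional_def)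
    then show "(\<lambda>i\<in>I. \<lambda>w\<in>V. (\<lambda>w\<in>V. \<lambda>i\<in>I. \<xi> i w) w i) = \<xi>"
      using \<xi> by (auto simp: fun_eq_iff PiE_iff extensional_def)
    show "(\<lambda>w\<in>V. \<lambda>i\<in>I. \<xi> i w) \<in> V \<rightarrow>\<^sub>E (I \<rightarrow>\<^sub>E K)"
      using \<xi> by (auto simp: PiE_iff)
    show "(\<Prod>i\<in>I. f (\<lambda>w\<in>V. (\<lambda>w\<in>V. \<lambda>i\<in>I. \<xi> i w) w i)) = (\<Prod>i\<in>I. f (\<xi> i))"
      by (intro prod.cong refl) (simp only: 1)
  next
    fix z assume z: "z \<in> V \<rightarrow>\<^sub>E (I \<rightarrow>\<^sub>E K)"
    then show "(\<lambda>w\<in>V. \<lambda>i\<in>I. (\<lambda>i\<in>I. \<lambda>w\<in>V. z w i) i w) = z"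
      by (auto simp: fun_eq_iff PiE_iff extensional_def)
    show "(\<lambda>i\<in>I. \<lambda>w\<in>V. z w i) \<in> I \<rightarrow>\<^sub>E (V \<rightarrow>\<^sub>E K)"
      using z by (auto simp: PiE_iff)
  qed
  finally show ?thesis by simp
qed

text \<open>The form matches the \<open>merge\<close> in \<open>restricted_density\<close>. The
  value type is left free: it is the reals for kernels on the unit square and a finite index set for
  step kernels.\<close>

definition extend :: "'a set \<Rightarrow> 'a \<Rightarrow> 'a \<Rightarrow> 'b \<Rightarrow> 'b \<Rightarrow> ('a \<Rightarrow> 'b) \<Rightarrow> 'a \<Rightarrow> 'b" where
  "extend V u v a b y = merge {u, v} (V - {u, v}) (\<lambda>w. if w = u then a else b, y)"

lemma extend_simps [simp]:
  "extend V u v a b y u = a"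
  "u \<noteq> v \<Longrightarrow> extend V u v a b y v = b"
  "w \<in> V \<Longrightarrow> w \<noteq> u \<Longrightarrow> w \<noteq> v \<Longrightarrow> extend V u v a b y w = y w"
  by (auto simp: extend_def merge_def)

lemma sum_PiE_extend:
  fixes f :: "('a \<Rightarrow> 'b) \<Rightarrow> real"
  assumes "u \<in> V" "v \<in> V" "u \<noteq> v"
  shows "(\<Sum>z\<in>V \<rightarrow>\<^sub>E K. f z) =
    (\<Sum>a\<in>K. \<Sum>b\<in>K. \<Sum>y\<in>(V - {u, v}) \<rightarrow>\<^sub>E K. f (extend V u v a b y))"
proof -
  have "(\<Sum>z\<in>V \<rightarrow>\<^sub>E K. f z) =
    (\<Sum>(a, b, y)\<in>K \<times> K \<times> ((V - {u, v}) \<rightarrow>\<^sub>E K). f (extend V u v a b y))"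
  proof (rule sum.reindex_bij_witness[of _ "\<lambda>(a, b, y). extend V u v a b y"
      "\<lambda>z. (z u, z v, restrict z (V - {u, v}))"])
    fix z assume z: "z \<in> V \<rightarrow>\<^sub>E K"
    have *: "extend V u v (z u) (z v) (restrict z (V - {u, v})) = z"
      using z assms by (auto simp: fun_eq_iff extend_def merge_def PiE_iff extensional_def)
    then show "(case (z u, z v, restrict z (V - {u, v})) of (a, b, y) \<Rightarrow> extend V u v a b y) = z"
      by simp
    show "(case (z u, z v, restrict z (V - {u, v})) of (a, b, y) \<Rightarrow> f (extend V u v a b y)) = f z"
      by (simp add: *)
    show "(z u, z v, restrict z (V - {u, v})) \<in> K \<times> K \<times> ((V - {u, v}) \<rightarrow>\<^sub>E K)"
      using z assms by (auto simp: PiE_iff)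
  next
    fix q assume "q \<in> K \<times> K \<times> ((V - {u, v}) \<rightarrow>\<^sub>E K)"
    then obtain a b y where q: "q = (a, b, y)" "a \<in> K" "b \<in> K" "y \<in> (V - {u, v}) \<rightarrow>\<^sub>E K" by auto
    show "(\<lambda>z. (z u, z v, restrict z (V - {u, v}))) (case q of (a, b, y) \<Rightarrow> extend V u v a b y) = q"
      using q assms by (auto simp: fun_eq_iff PiE_iff extensional_def)
    show "(case q of (a, b, y) \<Rightarrow> extend V u v a b y) \<in> V \<rightarrow>\<^sub>E K"
      using q assms by (auto simp: PiE_iff extensional_def extend_def merge_def)
  qed
  then show ?thesis by (simp add: sum.cartesian_product)
qed

text \<open>The exponential moment equals 1 at \<open>r = 0\<close>, and its derivative there is the
  mean, which is negative. This supplies the exponent of the Chernoff bound that serves as the law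
  of large numbers.\<close>

lemma exp_moment_less_one:
  fixes p g :: "'c \<Rightarrow> real"
  assumes "finite S" "(\<Sum>x\<in>S. p x) = 1" "(\<Sum>x\<in>S. p x * g x) < 0"
  shows "\<exists>r>0. (\<Sum>x\<in>S. p x * exp (r * g x)) < 1"
proof -
  have "((\<lambda>r. \<Sum>x\<in>S. p x * exp (r * g x)) has_real_derivative (\<Sum>x\<in>S. p x * g x)) (at 0)"
    by (auto intro!: derivative_eq_intros simp: mult.commute)
  from DERIV_neg_dec_right[OF this assms(3)] obtain d where "d > 0"
    "\<And>h. 0 < h \<Longrightarrow> h < d \<Longrightarrow> (\<Sum>x\<in>S. p x * exp (h * g x)) < 1"
    using assms(2) by auto
  from this(2)[of "d/2"] this(1) show ?thesis by (intro exI[of _ "d/2"]) simp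
qed

text \<open>The tensor power argument for a kernel on a finite set with the uniform distribution.
  The maps \<open>s\<close> and \<open>t\<close> orient the edges, so that the kernel is evaluated
  at ordered pairs. The hypothesis \<open>sid\<close> is the Sidorenko inequality on finite sets of
  functions \<open>nat \<Rightarrow> 'b\<close>; such functions encode the \<open>N\<close>-tuples
  over \<open>K\<close>.\<close>

lemma smooth_finite_kernel:
  fixes K :: "'b set" and A :: "'b \<Rightarrow> 'b \<Rightarrow> real" and s t :: "'e \<Rightarrow> 'a"
  assumes V: "finite V" "u \<in> V" "v \<in> V" "u \<noteq> v"
    and E: "finite E" "e0 \<in> E" "s e0 = u" "t e0 = v" "s ` E \<subseteq> V" "t ` E \<subseteq> V"
    and K: "finite K" "K \<noteq> {}"
    and A: "\<And>a b. a \<in> K \<Longrightarrow> b \<in> K \<Longrightarrow> 0 < A a b" "\<And>a b. a \<in> K \<Longrightarrow> b \<in> K \<Longrightarrow> A a b = A b a"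
    and sid: "\<And>(\<Omega> :: (nat \<Rightarrow> 'b) set) B. finite \<Omega> \<Longrightarrow> \<Omega> \<noteq> {} \<Longrightarrow>
      (\<And>a b. a \<in> \<Omega> \<Longrightarrow> b \<in> \<Omega> \<Longrightarrow> 0 \<le> B a b) \<Longrightarrow> (\<And>a b. a \<in> \<Omega> \<Longrightarrow> b \<in> \<Omega> \<Longrightarrow> B a b = B b a) \<Longrightarrow>
      ((\<Sum>a\<in>\<Omega>. \<Sum>b\<in>\<Omega>. B a b) / real (card \<Omega>) ^ 2) ^ card E
        \<le> (\<Sum>z\<in>V \<rightarrow>\<^sub>E \<Omega>. \<Prod>e\<in>E. B (z (s e)) (z (t e))) / real (card \<Omega>) ^ card V"
  defines "D \<equiv> \<Sum>a\<in>K. \<Sum>b\<in>K. A a b"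
    and "T \<equiv> \<lambda>a b. (\<Sum>y\<in>(V - {u, v}) \<rightarrow>\<^sub>E K. \<Prod>e\<in>E - {e0}.
      A (extend V u v a b y (s e)) (extend V u v a b y (t e))) / real (card K) ^ card (V - {u, v})"
  shows "(\<Sum>a\<in>K. \<Sum>b\<in>K. A a b / D * ln (T a b)) \<ge> real (card (E - {e0})) * ln (D / real (card K) ^ 2)"
proof -
  define n where "n = real (card K)"
  define c where "c = card (E - {e0})"
  define m where "m = n ^ card (V - {u, v})"
  have n0: "n > 0" using K by (auto simp: n_def card_gt_0_iff)
  have m0: "m > 0" using n0 by (simp add: m_def)
  have cardE: "card E = Suc c" using E card.remove[of E e0] by (simp add: c_def)
  have cardV: "n ^ card V = m * n ^ 2"
  proof -
    have "card V = card (V - {u, v}) + 2"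
      using V card_Diff_subset[of "{u,v}" V] card_mono[of V "{u,v}"] by auto
    then show ?thesis unfolding m_def by (simp only: power_add)
  qed
  have D0: "D > 0" unfolding D_def using K A(1) by (intro sum_pos) auto
  have ext: "extend V u v a b y w \<in> K" if "a \<in> K" "b \<in> K" "y \<in> (V - {u, v}) \<rightarrow>\<^sub>E K" "w \<in> V" for a b y w
    using that by (auto simp: extend_def merge_def)
  have T0: "T a b > 0" if "a \<in> K" "b \<in> K" for a b
  proof -
    have "(V - {u, v}) \<rightarrow>\<^sub>E K \<noteq> {}" using K by (auto simp: PiE_eq_empty_iff)
    then show ?thesis unfolding T_def using that K V E n0 n_def
      by (intro divide_pos_pos sum_pos prod_pos A(1) ext finite_PiE) auto
  qed
  define p where "p a b = A a b / D" for a b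
  have p0: "p a b > 0" if "a \<in> K" "b \<in> K" for a b using A(1)[OF that] D0 by (simp add: p_def)
  have psym: "p a b = p b a" if "a \<in> K" "b \<in> K" for a b using A(2)[OF that] by (simp add: p_def)
  have p1: "(\<Sum>a\<in>K. \<Sum>b\<in>K. p a b) = 1"
    using D0 by (simp add: p_def D_def flip: sum_divide_distrib)
  define \<mu> where "\<mu> = (\<Sum>a\<in>K. \<Sum>b\<in>K. p a b * ln (T a b))"
  have main: "real c * ln (D / n ^ 2) \<le> \<mu> + \<delta>" if \<delta>: "\<delta> > 0" for \<delta>
  proof -
    \<comment> \<open>The mean of \<open>g\<close> under the probability weights \<open>p\<close> is
      \<open>- \<delta>\<close>; this strict negativity yields the Chernoff exponent
      \<open>r\<close>.\<close>
    define g where "g a b = ln (T a b) - \<mu> - \<delta>" for a b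
    have "(\<Sum>a\<in>K. \<Sum>b\<in>K. p a b * g a b) = \<mu> - (\<mu> + \<delta>) * (\<Sum>a\<in>K. \<Sum>b\<in>K. p a b)"
      unfolding g_def \<mu>_def sum_distrib_left sum_subtractf[symmetric] by (simp add: algebra_simps)
    then have "(\<Sum>(a,b)\<in>K\<times>K. p a b * g a b) < 0"
      using p1 \<delta> by (simp add: sum.cartesian_product)
    then obtain r where r: "r > 0" "(\<Sum>(a,b)\<in>K\<times>K. p a b * exp (r * g a b)) < 1"
      using exp_moment_less_one[of "K\<times>K" "\<lambda>(a,b). p a b" "\<lambda>(a,b). g a b"] K p1
      by (auto simp: sum.cartesian_product split_def)
    define \<rho> where "\<rho> = (\<Sum>a\<in>K. \<Sum>b\<in>K. p a b * exp (r * g a b))"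
    have \<rho>1: "\<rho> < 1" using r by (simp add: \<rho>_def sum.cartesian_product)
    have \<rho>0: "\<rho> \<ge> 0" unfolding \<rho>_def by (intro sum_nonneg mult_nonneg_nonneg) (auto intro: less_imp_le p0)
    \<comment> \<open>\<open>X\<close> is the \<open>N\<close>-th root of the upper bound that the
      Sidorenko inequality produces; \<open>1 \<le> X\<close> is the claim after taking
      logarithms.\<close>
    define X where "X = exp (\<mu> + \<delta>) * (n ^ 2 / D) ^ c"
    have X0: "X > 0" unfolding X_def using n0 D0 by simp
    \<comment> \<open>\<open>\<rho> ^ N\<close> bounds the mass lost by truncating in one order of
      the pair, hence the factor 2. The condition keeps the base nonnegative, so that it may be
      raised to a power.\<close>
    have key: "(1 - 2 * \<rho> ^ N) ^ Suc c \<le> X ^ N" if "2 * \<rho> ^ N \<le> 1" for N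
    proof -
      define I where "I = {..<N}"
      define \<Omega> where "\<Omega> = I \<rightarrow>\<^sub>E K"
      have fin: "finite \<Omega>" "\<Omega> \<noteq> {}" "finite I" "card I = N"
        using K by (auto simp: \<Omega>_def I_def PiE_eq_empty_iff intro!: finite_PiE)
      have \<Omega>K: "\<alpha> i \<in> K" if "\<alpha> \<in> \<Omega>" "i \<in> I" for \<alpha> i using that by (auto simp: \<Omega>_def)
      have card\<Omega>: "real (card \<Omega>) = n ^ N"
        by (simp add: \<Omega>_def n_def I_def card_PiE)
      define P where "P \<alpha> \<beta> = (\<Prod>i\<in>I. p (\<alpha> i) (\<beta> i))" for \<alpha> \<beta>
      \<comment> \<open>\<open>G\<close> says that the average of \<open>ln T\<close> over the
        coordinates is at most \<open>\<mu> + \<delta>\<close>. As \<open>T\<close> need not be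
        symmetric, \<open>B\<close> imposes this in both orders so as to be a symmetric
        kernel.\<close>
      define G where "G \<alpha> \<beta> \<longleftrightarrow> (\<Sum>i\<in>I. g (\<alpha> i) (\<beta> i)) \<le> 0" for \<alpha> \<beta>
      define B where "B \<alpha> \<beta> = P \<alpha> \<beta> * (of_bool (G \<alpha> \<beta>) * of_bool (G \<beta> \<alpha>))" for \<alpha> \<beta>
      have P0: "P \<alpha> \<beta> > 0" if "\<alpha> \<in> \<Omega>" "\<beta> \<in> \<Omega>" for \<alpha> \<beta>
        unfolding P_def using that by (intro prod_pos p0 \<Omega>K) auto
      have Psym: "P \<alpha> \<beta> = P \<beta> \<alpha>" if "\<alpha> \<in> \<Omega>" "\<beta> \<in> \<Omega>" for \<alpha> \<beta>
        unfolding P_def using that by (intro prod.cong refl psym \<Omega>K) auto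
      have P1: "(\<Sum>\<alpha>\<in>\<Omega>. \<Sum>\<beta>\<in>\<Omega>. P \<alpha> \<beta>) = 1"
        unfolding P_def \<Omega>_def using sum_PiE_pair_prod[of I K p] fin K p1 by simp
      \<comment> \<open>Chernoff bound: where \<open>G\<close> fails, the sum of \<open>g\<close> is
        positive and \<open>exp (r * ...)\<close> is at least 1; the exponential factors over the
        coordinates.\<close>
      have bad: "(\<Sum>\<alpha>\<in>\<Omega>. \<Sum>\<beta>\<in>\<Omega>. P \<alpha> \<beta> * of_bool (\<not> G \<alpha> \<beta>)) \<le> \<rho> ^ N"
      proof -
        have "(\<Sum>\<alpha>\<in>\<Omega>. \<Sum>\<beta>\<in>\<Omega>. P \<alpha> \<beta> * of_bool (\<not> G \<alpha> \<beta>))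
          \<le> (\<Sum>\<alpha>\<in>\<Omega>. \<Sum>\<beta>\<in>\<Omega>. \<Prod>i\<in>I. p (\<alpha> i) (\<beta> i) * exp (r * g (\<alpha> i) (\<beta> i)))"
        proof (intro sum_mono)
          fix \<alpha> \<beta> assume ab: "\<alpha> \<in> \<Omega>" "\<beta> \<in> \<Omega>"
          have "of_bool (\<not> G \<alpha> \<beta>) \<le> exp (r * (\<Sum>i\<in>I. g (\<alpha> i) (\<beta> i)))"
            using r(1) by (auto simp: G_def)
          also have "\<dots> = (\<Prod>i\<in>I. exp (r * g (\<alpha> i) (\<beta> i)))"
            using fin by (simp add: exp_sum sum_distrib_left)
          finally show "P \<alpha> \<beta> * of_bool (\<not> G \<alpha> \<beta>) \<le> (\<Prod>i\<in>I. p (\<alpha> i) (\<beta> i) * exp (r * g (\<alpha> i) (\<beta> i)))"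
            using P0[OF ab] by (simp add: prod.distrib P_def)
        qed
        also have "\<dots> = \<rho> ^ N"
          unfolding \<Omega>_def \<rho>_def
          using sum_PiE_pair_prod[of I K "\<lambda>a b. p a b * exp (r * g a b)"] fin K by simp
        finally show ?thesis .
      qed
      have bad': "(\<Sum>\<alpha>\<in>\<Omega>. \<Sum>\<beta>\<in>\<Omega>. P \<alpha> \<beta> * of_bool (\<not> G \<beta> \<alpha>)) \<le> \<rho> ^ N"
      proof -
        have "(\<Sum>\<alpha>\<in>\<Omega>. \<Sum>\<beta>\<in>\<Omega>. P \<alpha> \<beta> * of_bool (\<not> G \<beta> \<alpha>)) = (\<Sum>\<alpha>\<in>\<Omega>. \<Sum>\<beta>\<in>\<Omega>. P \<alpha> \<beta> * of_bool (\<not> G \<alpha> \<beta>))"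
          by (subst sum.swap) (intro sum.cong refl, simp add: Psym)
        then show ?thesis using bad by simp
      qed
      have mass: "1 - 2 * \<rho> ^ N \<le> (\<Sum>\<alpha>\<in>\<Omega>. \<Sum>\<beta>\<in>\<Omega>. B \<alpha> \<beta>)"
      proof -
        have "1 - 2 * \<rho> ^ N \<le> (\<Sum>\<alpha>\<in>\<Omega>. \<Sum>\<beta>\<in>\<Omega>. P \<alpha> \<beta>) - (\<Sum>\<alpha>\<in>\<Omega>. \<Sum>\<beta>\<in>\<Omega>. P \<alpha> \<beta> * of_bool (\<not> G \<alpha> \<beta>))
            - (\<Sum>\<alpha>\<in>\<Omega>. \<Sum>\<beta>\<in>\<Omega>. P \<alpha> \<beta> * of_bool (\<not> G \<beta> \<alpha>))"
          using bad bad' P1 by linarith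
        \<comment> \<open>Union bound, pair by pair: a pair discarded by \<open>B\<close> fails
          \<open>G\<close> in at least one of the two orders.\<close>
        also have "\<dots> \<le> (\<Sum>\<alpha>\<in>\<Omega>. \<Sum>\<beta>\<in>\<Omega>. B \<alpha> \<beta>)"
          unfolding sum_subtractf[symmetric] B_def
          by (intro sum_mono) (use P0 in \<open>force simp: of_bool_def\<close>)
        finally show ?thesis .
      qed
      \<comment> \<open>The contribution of a single coordinate to the bound on the homomorphism sum
        of \<open>B\<close>.\<close>
      define R where "R = (\<Sum>\<zeta>\<in>V \<rightarrow>\<^sub>E K. exp (- g (\<zeta> u) (\<zeta> v)) * (\<Prod>e\<in>E. p (\<zeta> (s e)) (\<zeta> (t e))))"
      have hom: "(\<Sum>z\<in>V \<rightarrow>\<^sub>E \<Omega>. \<Prod>e\<in>E. B (z (s e)) (z (t e))) \<le> R ^ N"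
      proof -
        have "(\<Sum>z\<in>V \<rightarrow>\<^sub>E \<Omega>. \<Prod>e\<in>E. B (z (s e)) (z (t e)))
          \<le> (\<Sum>z\<in>V \<rightarrow>\<^sub>E \<Omega>. \<Prod>i\<in>I. (\<lambda>\<zeta>. exp (- g (\<zeta> u) (\<zeta> v)) * (\<Prod>e\<in>E. p (\<zeta> (s e)) (\<zeta> (t e)))) (\<lambda>w\<in>V. z w i))"
        proof (rule sum_mono)
          fix z assume z: "z \<in> V \<rightarrow>\<^sub>E \<Omega>"
          then have z\<Omega>: "z w \<in> \<Omega>" if "w \<in> V" for w using that by auto
          have P0': "P (z (s e)) (z (t e)) > 0" if "e \<in> E" for e
            using that E by (intro P0 z\<Omega>) auto
          have B01: "0 \<le> B (z (s e)) (z (t e))" "B (z (s e)) (z (t e)) \<le> P (z (s e)) (z (t e))" if "e \<in> E" for e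
            using P0'[OF that] by (auto simp: B_def of_bool_def)
          have st: "s e \<in> V" "t e \<in> V" if "e \<in> E" for e using that E by auto
          have "(\<Prod>e\<in>E. B (z (s e)) (z (t e))) = B (z u) (z v) * (\<Prod>e\<in>E - {e0}. B (z (s e)) (z (t e)))"
            using E by (simp add: prod.remove[of E e0])
          \<comment> \<open>Only the factor of \<open>e0\<close> keeps a truncation, and only in the
            order from \<open>u\<close> to \<open>v\<close>; every other factor is bounded by the
            untruncated \<open>P\<close>.\<close>
          also have "\<dots> \<le> (P (z u) (z v) * of_bool (G (z u) (z v))) * (\<Prod>e\<in>E - {e0}. P (z (s e)) (z (t e)))"
          proof (rule mult_mono)
            show "B (z u) (z v) \<le> P (z u) (z v) * of_bool (G (z u) (z v))"
              using P0[OF z\<Omega>[of u] z\<Omega>[of v]] V by (auto simp: B_def)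
            show "(\<Prod>e\<in>E - {e0}. B (z (s e)) (z (t e))) \<le> (\<Prod>e\<in>E - {e0}. P (z (s e)) (z (t e)))"
              using B01 by (intro prod_mono) auto
            show "0 \<le> P (z u) (z v) * of_bool (G (z u) (z v))"
              using P0[OF z\<Omega>[of u] z\<Omega>[of v]] V by auto
            show "0 \<le> (\<Prod>e\<in>E - {e0}. B (z (s e)) (z (t e)))"
              using B01 by (intro prod_nonneg) auto
          qed
          also have "\<dots> = of_bool (G (z u) (z v)) * (\<Prod>e\<in>E. P (z (s e)) (z (t e)))"
            using E by (simp add: prod.remove[of E e0])
          \<comment> \<open>On \<open>G\<close> the sum of \<open>g\<close> is at most 0, so this
            exponential is at least 1. The rate is 1 here instead of \<open>r\<close>, so that
            \<open>exp (- g a b)\<close> carries exactly the factor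
            \<open>1 / T a b\<close>.\<close>
          also have "\<dots> \<le> (\<Prod>i\<in>I. exp (- g (z u i) (z v i))) * (\<Prod>e\<in>E. P (z (s e)) (z (t e)))"
          proof (rule mult_right_mono)
            have "of_bool (G (z u) (z v)) \<le> exp (- (\<Sum>i\<in>I. g (z u i) (z v i)))"
              by (auto simp: G_def)
            also have "\<dots> = (\<Prod>i\<in>I. exp (- g (z u i) (z v i)))"
              using fin by (simp add: exp_sum flip: sum_negf)
            finally show "of_bool (G (z u) (z v)) \<le> (\<Prod>i\<in>I. exp (- g (z u i) (z v i)))" .
            show "0 \<le> (\<Prod>e\<in>E. P (z (s e)) (z (t e)))"
              using P0' by (intro prod_nonneg) (auto intro: less_imp_le)
          qed
          also have "(\<Prod>e\<in>E. P (z (s e)) (z (t e))) = (\<Prod>i\<in>I. \<Prod>e\<in>E. p (z (s e) i) (z (t e) i))"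
            unfolding P_def by (rule prod.swap)
          also have "(\<Prod>i\<in>I. exp (- g (z u i) (z v i))) * \<dots> =
            (\<Prod>i\<in>I. (\<lambda>\<zeta>. exp (- g (\<zeta> u) (\<zeta> v)) * (\<Prod>e\<in>E. p (\<zeta> (s e)) (\<zeta> (t e)))) (\<lambda>w\<in>V. z w i))"
            using V st by (simp add: prod.distrib cong: prod.cong)
          finally show "(\<Prod>e\<in>E. B (z (s e)) (z (t e))) \<le> \<dots>" .
        qed
        also have "\<dots> = R ^ N"
          unfolding \<Omega>_def R_def
          using sum_PiE_flip_prod[of V I K "\<lambda>\<zeta>. exp (- g (\<zeta> u) (\<zeta> v)) * (\<Prod>e\<in>E. p (\<zeta> (s e)) (\<zeta> (t e)))"] V K fin
          by simp
        finally show ?thesis .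
      qed
      have R: "R = exp (\<mu> + \<delta>) * m / D ^ c"
      proof -
        have "R = (\<Sum>a\<in>K. \<Sum>b\<in>K. \<Sum>y\<in>(V - {u, v}) \<rightarrow>\<^sub>E K. exp (- g a b) * (p a b *
            (\<Prod>e\<in>E - {e0}. p (extend V u v a b y (s e)) (extend V u v a b y (t e)))))"
          unfolding R_def using V E
          by (subst sum_PiE_extend[of u V v]) (simp_all add: prod.remove[of E e0])
        \<comment> \<open>Summing over the unlabeled coordinates reproduces \<open>T a b\<close>,
          which cancels against \<open>exp (- g a b)\<close>. What is left is a constant times
          \<open>p\<close>, whose total mass is 1.\<close>
        also have "\<dots> = (\<Sum>a\<in>K. \<Sum>b\<in>K. exp (\<mu> + \<delta>) * m / D ^ c * p a b)"
        proof (intro sum.cong refl)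
          fix a b assume ab: "a \<in> K" "b \<in> K"
          have expg: "exp (- g a b) = exp (\<mu> + \<delta>) / T a b"
          proof -
            have "- g a b = (\<mu> + \<delta>) - ln (T a b)" by (simp add: g_def)
            then show ?thesis using T0[OF ab] by (simp add: exp_diff)
          qed
          have "(\<Sum>y\<in>(V - {u, v}) \<rightarrow>\<^sub>E K. exp (- g a b) * (p a b *
            (\<Prod>e\<in>E - {e0}. p (extend V u v a b y (s e)) (extend V u v a b y (t e)))))
            = exp (- g a b) * p a b * (\<Sum>y\<in>(V - {u, v}) \<rightarrow>\<^sub>E K.
              (\<Prod>e\<in>E - {e0}. A (extend V u v a b y (s e)) (extend V u v a b y (t e))) / D ^ c)"
            by (simp add: p_def prod_dividef sum_distrib_left c_def mult_ac)
          also have "(\<Sum>y\<in>(V - {u, v}) \<rightarrow>\<^sub>E K.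
              (\<Prod>e\<in>E - {e0}. A (extend V u v a b y (s e)) (extend V u v a b y (t e))) / D ^ c) = m * T a b / D ^ c"
            unfolding sum_divide_distrib[symmetric] T_def using m0 by (simp add: m_def n_def)
          also have "exp (- g a b) * p a b * (m * T a b / D ^ c) = exp (\<mu> + \<delta>) * m / D ^ c * p a b"
            unfolding expg using T0[OF ab] by simp
          finally show "(\<Sum>y\<in>(V - {u, v}) \<rightarrow>\<^sub>E K. exp (- g a b) * (p a b *
            (\<Prod>e\<in>E - {e0}. p (extend V u v a b y (s e)) (extend V u v a b y (t e)))))
            = exp (\<mu> + \<delta>) * m / D ^ c * p a b" .
        qed
        also have "\<dots> = exp (\<mu> + \<delta>) * m / D ^ c"
          unfolding sum_distrib_left[symmetric] p1 by simp
        finally show ?thesis .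
      qed
      have B0: "0 \<le> B \<alpha> \<beta>" if "\<alpha> \<in> \<Omega>" "\<beta> \<in> \<Omega>" for \<alpha> \<beta>
        using P0[OF that] by (simp add: B_def)
      have Bsym: "B \<alpha> \<beta> = B \<beta> \<alpha>" if "\<alpha> \<in> \<Omega>" "\<beta> \<in> \<Omega>" for \<alpha> \<beta>
        using Psym[OF that] by (simp add: B_def mult_ac)
      have nN: "(n ^ N) ^ k = (n ^ k) ^ N" for k by (simp add: mult.commute flip: power_mult)
      have "((1 - 2 * \<rho> ^ N) / (n ^ N) ^ 2) ^ Suc c \<le> ((\<Sum>\<alpha>\<in>\<Omega>. \<Sum>\<beta>\<in>\<Omega>. B \<alpha> \<beta>) / (n ^ N) ^ 2) ^ Suc c"
        using mass that n0 by (intro power_mono divide_right_mono) auto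
      also have "\<dots> \<le> (\<Sum>z\<in>V \<rightarrow>\<^sub>E \<Omega>. \<Prod>e\<in>E. B (z (s e)) (z (t e))) / (n ^ N) ^ card V"
        using sid[of \<Omega> B, OF fin(1,2) B0 Bsym] by (simp only: card\<Omega> cardE)
      also have "\<dots> \<le> R ^ N / (n ^ N) ^ card V"
        using hom n0 by (intro divide_right_mono) auto
      also have "\<dots> = (exp (\<mu> + \<delta>) / D ^ c / n ^ 2) ^ N"
        unfolding nN cardV R using m0 by (simp flip: power_divide)
      \<comment> \<open>Of the \<open>Suc c\<close> factors \<open>n ^ 2\<close>, one cancels the
        contribution of the two labeled coordinates; the other \<open>c\<close> enter
        \<open>X\<close>.\<close>
      finally have "(1 - 2 * \<rho> ^ N) ^ Suc c \<le> (exp (\<mu> + \<delta>) / D ^ c / n ^ 2) ^ N * ((n ^ N) ^ 2) ^ Suc c"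
        using n0 by (simp add: power_divide divide_le_eq)
      also have "((n ^ N) ^ 2) ^ Suc c = ((n ^ 2) ^ Suc c) ^ N"
        by (simp only: mult_ac flip: power_mult)
      also have "(exp (\<mu> + \<delta>) / D ^ c / n ^ 2) ^ N * ((n ^ 2) ^ Suc c) ^ N = X ^ N"
        unfolding X_def power_mult_distrib[symmetric] using n0 by (simp add: power_divide)
      finally show ?thesis .
    qed
    \<comment> \<open>If \<open>X < 1\<close>, the right-hand side of \<open>key\<close> tends to 0
      while its left-hand side tends to 1.\<close>
    have "X \<ge> 1"
    proof (rule ccontr)
      assume "\<not> X \<ge> 1"
      then have "(\<lambda>N. X ^ N) \<longlonglongrightarrow> 0" using X0 by (intro LIMSEQ_power_zero) auto
      moreover have \<rho>lim: "(\<lambda>N. \<rho> ^ N) \<longlonglongrightarrow> 0" using \<rho>0 \<rho>1 by (intro LIMSEQ_power_zero) auto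
      then have "(\<lambda>N. (1 - 2 * \<rho> ^ N) ^ Suc c) \<longlonglongrightarrow> (1 - 2 * 0) ^ Suc c"
        by (intro tendsto_power tendsto_diff tendsto_mult tendsto_const)
      moreover have "eventually (\<lambda>N. \<rho> ^ N < 1/2) sequentially"
        using \<rho>lim by (rule order_tendstoD) simp
      then have "eventually (\<lambda>N. (1 - 2 * \<rho> ^ N) ^ Suc c \<le> X ^ N) sequentially"
        by eventually_elim (rule key, simp)
      ultimately have "(1 - 2 * 0) ^ Suc c \<le> (0::real)"
        using tendsto_le[OF sequentially_bot] by blast
      then show False by simp
    qed
    then have "0 \<le> ln X" by simp
    also have "ln X = \<mu> + \<delta> + real c * ln (n ^ 2 / D)"
      unfolding X_def using n0 D0 by (simp add: ln_mult ln_realpow)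
    also have "ln (n ^ 2 / D) = - ln (D / n ^ 2)" using n0 D0 by (simp add: ln_div)
    finally show ?thesis by simp
  qed
  have "real c * ln (D / n ^ 2) \<le> \<mu>"
    by (rule field_le_epsilon) (rule main)
  then show ?thesis by (simp add: \<mu>_def p_def c_def n_def)
qed

section \<open>The unit square and its completion\<close>

abbreviation unit_measure :: "real measure" where
  "unit_measure \<equiv> restrict_space lborel {0..1}"

abbreviation unit_square :: "(real \<times> real) set" where
  "unit_square \<equiv> {0..1} \<times> {0..1}"

lemma prob_space_unit_measure: "prob_space unit_measure"
  by (intro prob_spaceI) (simp add: space_restrict_space emeasure_restrict_space)

interpretation unit: prob_space unit_measure
  by (rule prob_space_unit_measure)

interpretation unit_pair: pair_prob_space unit_measure unit_measure
  by unfold_locales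

interpretation unit_prod: product_prob_space "\<lambda>_. unit_measure" I for I :: "'i set"
  by unfold_locales

lemma space_unit_measure [simp]: "space unit_measure = {0..1}"
  by (simp add: space_restrict_space)

lemma sets_unit_measure: "A \<in> sets unit_measure \<longleftrightarrow> A \<in> sets borel \<and> A \<subseteq> {0..1}"
  by (auto simp: sets_restrict_space_iff)

lemma sets_unit_square [simp]: "unit_square \<in> sets borel"
  by (intro borel_closed closed_Times closed_real_atLeastAtMost)

text \<open>The identity is measurable in both directions, so the sigma-algebras agree, and both
  measures give rectangles the product of the side measures. Hence Fubini arguments on the product
  transfer to \<open>lebesgue_on unit_square\<close>, its completion.\<close>

lemma unit_measure_pair: "unit_measure \<Otimes>\<^sub>M unit_measure = restrict_space lborel unit_square"
proof (rule pair_measure_eqI)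
  show "sigma_finite_measure unit_measure" by unfold_locales
  show "sigma_finite_measure unit_measure" by unfold_locales
  let ?P = "unit_measure \<Otimes>\<^sub>M unit_measure" and ?R = "restrict_space lborel unit_square"
  have spaces: "space ?P = unit_square" "space ?R = unit_square"
    by (simp_all add: space_pair_measure space_restrict_space)
  have "(\<lambda>p. p) \<in> ?R \<rightarrow>\<^sub>M ?P"
    unfolding measurable_pair_iff comp_def
    by (intro conjI measurable_restrict_space2 measurable_restrict_space1)
       (auto simp: space_restrict_space borel_measurable_continuous_onI continuous_on_fst continuous_on_snd)
  then have 1: "A \<in> sets ?R" if "A \<in> sets ?P" for A
    using measurable_sets[of "\<lambda>p. p" ?R ?P A] sets.sets_into_space[OF that] that spaces
    by (simp add: Int_absorb2)
  have id1: "(\<lambda>x. x) \<in> unit_measure \<rightarrow>\<^sub>M borel"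
    by (intro measurable_restrict_space1) auto
  have "(\<lambda>p. (fst p, snd p)) \<in> ?P \<rightarrow>\<^sub>M borel \<Otimes>\<^sub>M borel"
    using measurable_compose[OF measurable_fst id1] measurable_compose[OF measurable_snd id1]
    by (intro measurable_Pair) auto
  then have "(\<lambda>p. p) \<in> ?P \<rightarrow>\<^sub>M (lborel :: (real \<times> real) measure)"
    by (simp add: borel_prod)
  then have "(\<lambda>p. p) \<in> ?P \<rightarrow>\<^sub>M ?R"
    by (intro measurable_restrict_space2) (auto simp: space_pair_measure)
  then have 2: "A \<in> sets ?P" if "A \<in> sets ?R" for A
    using measurable_sets[of "\<lambda>p. p" ?P ?R A] sets.sets_into_space[OF that] that spaces
    by (simp add: Int_absorb2)
  show "sets ?P = sets ?R" using 1 2 by auto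
  fix A B assume AB: "A \<in> sets unit_measure" "B \<in> sets unit_measure"
  then have "A \<in> sets lborel" "B \<in> sets lborel" "A \<subseteq> {0..1}" "B \<subseteq> {0..1}"
    by (auto simp: sets_unit_measure)
  moreover have "emeasure (lborel :: (real \<times> real) measure) (A \<times> B) = emeasure lborel A * emeasure lborel B"
    using calculation by (simp add: lborel.emeasure_pair_measure_Times flip: lborel_prod)
  moreover have "A \<times> B \<subseteq> unit_square" using calculation by auto
  ultimately show "emeasure unit_measure A * emeasure unit_measure B = emeasure ?R (A \<times> B)"
    by (simp add: emeasure_restrict_space borel_Times)
qed

lemma AE_lebesgue_on_unit_square:
  "(AE p in lebesgue_on unit_square. Q p) \<longleftrightarrow> (AE p in unit_measure \<Otimes>\<^sub>M unit_measure. Q p)"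
  unfolding unit_measure_pair by (simp add: AE_restrict_space_iff AE_completion_iff)

text \<open>Exchanging the coordinates preserves the product measure. This handles edges at the
  second label and the symmetrisation of approximating kernels.\<close>

lemma AE_unit_pair_swap:
  assumes "AE p in unit_measure \<Otimes>\<^sub>M unit_measure. R (fst p) (snd p)"
  shows "AE p in unit_measure \<Otimes>\<^sub>M unit_measure. R (snd p) (fst p)"
proof -
  let ?P = "unit_measure \<Otimes>\<^sub>M unit_measure"
  have "(\<lambda>(x, y). (y, x)) \<in> ?P \<rightarrow>\<^sub>M ?P" by (rule measurable_pair_swap')
  moreover have "AE p in distr ?P ?P (\<lambda>(x, y). (y, x)). R (fst p) (snd p)"
    using assms by (simp only: unit_pair.distr_pair_swap[symmetric])
  ultimately have "AE p in ?P. R (fst (case p of (x, y) \<Rightarrow> (y, x))) (snd (case p of (x, y) \<Rightarrow> (y, x)))"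
    by (rule AE_distrD)
  then show ?thesis by (simp add: split_def)
qed

lemma measurable_lebesgue_on_unit_square:
  fixes f :: "real \<times> real \<Rightarrow> real"
  assumes "f \<in> borel_measurable (unit_measure \<Otimes>\<^sub>M unit_measure)"
  shows "f \<in> borel_measurable (lebesgue_on unit_square)"
  using assms unfolding unit_measure_pair
  by (auto simp: borel_measurable_restrict_space_iff intro!: measurable_completion)

lemma integral_lebesgue_on_unit_square:
  fixes f :: "real \<times> real \<Rightarrow> real"
  assumes "f \<in> borel_measurable (unit_measure \<Otimes>\<^sub>M unit_measure)"
  shows "integral\<^sup>L (lebesgue_on unit_square) f = integral\<^sup>L (unit_measure \<Otimes>\<^sub>M unit_measure) f"
  using assms unfolding unit_measure_pair
  by (simp add: integral_restrict_space borel_measurable_restrict_space_iff integral_completion)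

lemma prob_space_lebesgue_on_unit_square: "prob_space (lebesgue_on unit_square)"
proof (rule prob_spaceI)
  have "emeasure lborel unit_square = emeasure (unit_measure \<Otimes>\<^sub>M unit_measure) unit_square"
    by (simp add: unit_measure_pair emeasure_restrict_space borel_Times)
  also have "\<dots> = 1"
    using unit_pair.P.emeasure_space_1 by (simp add: space_pair_measure)
  finally show "emeasure (lebesgue_on unit_square) (space (lebesgue_on unit_square)) = 1"
    by (simp add: emeasure_restrict_space borel_Times)
qed

interpretation lebesgue_square: prob_space "lebesgue_on unit_square"
  by (rule prob_space_lebesgue_on_unit_square)

section \<open>Complete measures and almost everywhere limits\<close>

lemma complete_measure_lebesgue_on:
  assumes "S \<in> sets lebesgue"
  shows "complete_measure (lebesgue_on S)"
proof
  fix A B assume "B \<subseteq> A" "A \<in> null_sets (lebesgue_on S)"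
  then have "A \<in> null_sets lebesgue" "A \<subseteq> S" using assms by (auto simp: null_sets_restrict_space)
  then show "B \<in> sets (lebesgue_on S)"
    using \<open>B \<subseteq> A\<close> assms completion.complete[of B A lborel] by (auto simp: sets_restrict_space_iff)
qed

text \<open>Setting everything to 0 on the exceptional null set gives a pointwise limit; on that
  null set, completeness makes every preimage measurable.\<close>

lemma (in complete_measure) borel_measurable_AE_LIMSEQ:
  fixes f :: "'a \<Rightarrow> real"
  assumes F: "\<And>n. F n \<in> borel_measurable M" and lim: "AE x in M. (\<lambda>n. F n x) \<longlonglongrightarrow> f x"
  shows "f \<in> borel_measurable M"
proof -
  from lim obtain N where N: "N \<in> null_sets M" "{x \<in> space M. \<not> (\<lambda>n. F n x) \<longlonglongrightarrow> f x} \<subseteq> N"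
    unfolding eventually_ae_filter by auto
  define g where "g x = (if x \<in> N then 0 else f x)" for x
  have [measurable]: "N \<in> sets M" using N by auto
  have g: "g \<in> borel_measurable M"
  proof (rule borel_measurable_LIMSEQ_real)
    show "(\<lambda>n. if x \<in> N then 0 else F n x) \<longlonglongrightarrow> g x" if "x \<in> space M" for x
      using N(2) that by (auto simp: g_def)
    show "(\<lambda>x. if x \<in> N then 0 else F n x) \<in> borel_measurable M" for n
      using F[of n] by measurable
  qed
  show ?thesis
  proof (rule measurableI)
    fix A :: "real set" assume A: "A \<in> sets borel"
    have eq: "f -` A \<inter> space M = ((g -` A \<inter> space M) - N) \<union> (f -` A \<inter> space M \<inter> N)"
      by (auto simp: g_def)
    have "f -` A \<inter> space M \<inter> N \<in> sets M"
      by (rule complete[OF _ N(1)]) auto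
    then show "f -` A \<inter> space M \<in> sets M"
      using measurable_sets[OF g A] by (subst eq) auto
  qed auto
qed

text \<open>Two distinct coordinates of the cube are independent and uniform, as seen on rectangles.
  This serves edges whose ends are both unlabeled.\<close>

lemma distr_PiM_pair:
  fixes I :: "'i set"
  assumes ij: "finite I" "i \<in> I" "j \<in> I" "i \<noteq> j"
  shows "distr (\<Pi>\<^sub>M i\<in>I. unit_measure) (unit_measure \<Otimes>\<^sub>M unit_measure) (\<lambda>y. (y i, y j))
    = unit_measure \<Otimes>\<^sub>M unit_measure"
proof (rule pair_measure_eqI[symmetric])
  show "sigma_finite_measure unit_measure" by unfold_locales
  show "sigma_finite_measure unit_measure" by unfold_locales
  have meas: "(\<lambda>y. (y i, y j)) \<in> (\<Pi>\<^sub>M i\<in>I. unit_measure) \<rightarrow>\<^sub>M unit_measure \<Otimes>\<^sub>M unit_measure"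
    using ij by (intro measurable_Pair measurable_component_singleton)
  fix A B assume AB: "A \<in> sets unit_measure" "B \<in> sets unit_measure"
  let ?X = "\<lambda>k. if k = i then A else B"
  have "emeasure (distr (\<Pi>\<^sub>M i\<in>I. unit_measure) (unit_measure \<Otimes>\<^sub>M unit_measure) (\<lambda>y. (y i, y j))) (A \<times> B)
    = emeasure (\<Pi>\<^sub>M i\<in>I. unit_measure) {y \<in> space (\<Pi>\<^sub>M i\<in>I. unit_measure). \<forall>k\<in>{i, j}. y k \<in> ?X k}"
    using AB ij by (subst emeasure_distr[OF meas]) (auto intro!: arg_cong2[where f = emeasure])
  also have "\<dots> = (\<Prod>k\<in>{i, j}. emeasure unit_measure (?X k))"
    using AB ij by (intro unit_prod.emeasure_PiM_Collect) auto
  also have "\<dots> = emeasure unit_measure A * emeasure unit_measure B"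
    using ij by simp
  finally show "emeasure unit_measure A * emeasure unit_measure B = emeasure (distr (\<Pi>\<^sub>M i\<in>I. unit_measure) (unit_measure \<Otimes>\<^sub>M unit_measure) (\<lambda>y. (y i, y j))) (A \<times> B)"
    by simp
qed simp

section \<open>Step kernels\<close>

text \<open>The definite description ranges over the two orders of the edge, and symmetry makes
  their values equal.\<close>

lemma edge_weight_eq:
  assumes "W (x i) (x j) = W (x j) (x i)"
  shows "edge_weight W x {i, j} = W (x i) (x j)"
  unfolding edge_weight_def by (rule the_equality) (use assms in \<open>auto simp: doubleton_eq_iff\<close>)

text \<open>The \<open>min\<close> puts the endpoint 1 into the last cell. For positive
  \<open>k\<close> the value lies below \<open>k\<close> at every real number, not only on the unit
  interval.\<close>

definition cell :: "nat \<Rightarrow> real \<Rightarrow> nat" where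
  "cell k x = min (k - 1) (nat \<lfloor>real k * x\<rfloor>)"

lemma cell_less: "k > 0 \<Longrightarrow> cell k x < k"
  by (auto simp: cell_def)

lemma measurable_cell [measurable]: "cell k \<in> borel \<rightarrow>\<^sub>M count_space UNIV"
  unfolding cell_def by measurable

lemma measurable_cell_unit_measure: "cell k \<in> unit_measure \<rightarrow>\<^sub>M count_space UNIV"
  by (intro measurable_restrict_space1) simp

text \<open>The strict upper bound is absent for the last cell, which contains 1.\<close>

lemma cell_eq_iff:
  assumes "x \<in> {0..1}" "j < k"
  shows "cell k x = j \<longleftrightarrow> real j \<le> real k * x \<and> (Suc j < k \<longrightarrow> real k * x < real (Suc j))"
proof -
  have "nat \<lfloor>real k * x\<rfloor> = i \<longleftrightarrow> real i \<le> real k * x \<and> real k * x < real (Suc i)" for i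
    using assms by (simp add: nat_eq_iff floor_eq_iff) linarith
  moreover have "k - 1 \<le> nat \<lfloor>real k * x\<rfloor> \<longleftrightarrow> real (k - 1) \<le> real k * x"
    using assms by (subst le_nat_iff) (auto simp: le_floor_iff)
  ultimately show ?thesis
    using assms by (cases "Suc j < k") (auto simp: cell_def min_def not_less)
qed

lemma measure_cell:
  assumes "j < k"
  shows "measure unit_measure {x \<in> {0..1}. cell k x = j} = 1 / real k"
proof -
  have k: "real k > 0" using assms by simp
  have le: "real j / real k \<ge> 0" "real (Suc j) / real k \<le> 1" using assms k by (auto simp: divide_le_eq)
  have eq: "{x \<in> {0..1}. cell k x = j} = (if Suc j < k then {real j / real k..<real (Suc j) / real k} else {real j / real k..1})"
    (is "_ = ?S")
  proof (intro set_eqI iffI)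
    fix x assume "x \<in> {x \<in> {0..1}. cell k x = j}"
    then have "x \<in> {0..1}" "cell k x = j" by auto
    then show "x \<in> ?S" using cell_eq_iff[of x j k] assms k by (auto simp: field_simps)
  next
    fix x assume x: "x \<in> ?S"
    then have "real j / real k \<le> x" by (auto split: if_splits)
    moreover have "x \<le> 1"
    proof (cases "Suc j < k")
      case True
      then have "x < real (Suc j) / real k" using x by simp
      with le(2) show ?thesis by linarith
    qed (use x in simp)
    moreover have "0 \<le> x" using calculation(1) le(1) by linarith
    ultimately have "x \<in> {0..1}" by simp
    then show "x \<in> {x \<in> {0..1}. cell k x = j}"
      using x cell_eq_iff[of x j k] assms k by (auto simp: field_simps split: if_splits)
  qed
  have "?S \<subseteq> {0..1}" unfolding eq[symmetric] by auto
  then have "measure unit_measure ?S = measure lborel ?S"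
    by (intro measure_restrict_space) auto
  moreover have "measure lborel ?S = 1 / real k"
  proof (cases "Suc j < k")
    case True
    then show ?thesis using k by (simp add: divide_right_mono field_simps)
  next
    case False
    then have "k = Suc j" using assms by simp
    then show ?thesis using k by (simp add: field_simps)
  qed
  ultimately show ?thesis unfolding eq by simp
qed

text \<open>Such a map pushes Lebesgue measure on the unit interval forward to the uniform
  distribution on \<open>K\<close>, so a kernel on \<open>K\<close> pulls back to a step kernel with
  the same densities. Membership in \<open>K\<close> is required on the whole line, which spares
  side conditions.\<close>

definition uniform_map :: "(real \<Rightarrow> 'b) \<Rightarrow> 'b set \<Rightarrow> bool" where
  "uniform_map q K \<longleftrightarrow> finite K \<and> (\<forall>x. q x \<in> K) \<and> q \<in> unit_measure \<rightarrow>\<^sub>M count_space UNIV \<and>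
     (\<forall>a\<in>K. measure unit_measure {x \<in> {0..1}. q x = a} = 1 / real (card K))"

lemma uniform_map_cell: "k > 0 \<Longrightarrow> uniform_map (cell k) {..<k}"
  unfolding uniform_map_def
  using measure_cell[of _ k] by (auto simp: cell_less measurable_cell_unit_measure)

lemma uniform_map_exists:
  assumes "finite K" "K \<noteq> {}"
  shows "\<exists>q. uniform_map q K"
proof -
  obtain h where h: "bij_betw h {..<card K} K"
    using ex_bij_betw_nat_finite[OF assms(1)] by (auto simp: atLeast0LessThan)
  have k: "card K > 0" using assms by (simp add: card_gt_0_iff)
  have "measure unit_measure {x \<in> {0..1}. h (cell (card K) x) = a} = 1 / real (card K)" if a: "a \<in> K" for a
  proof -
    obtain j where j: "j < card K" "a = h j" using h a by (auto simp: bij_betw_def)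
    then have "{x \<in> {0..1}. h (cell (card K) x) = a} = {x \<in> {0..1}. cell (card K) x = j}"
      using h cell_less[OF k] by (auto simp: bij_betw_def inj_on_def)
    then show ?thesis using measure_cell[OF j(1)] by simp
  qed
  moreover have "(\<lambda>x. h (cell (card K) x)) \<in> unit_measure \<rightarrow>\<^sub>M count_space UNIV"
    by (rule measurable_compose[OF measurable_cell_unit_measure]) simp
  moreover have "h (cell (card K) x) \<in> K" for x
    using h cell_less[OF k] by (auto simp: bij_betw_def)
  ultimately have "uniform_map (\<lambda>x. h (cell (card K) x)) K"
    using assms by (auto simp: uniform_map_def)
  then show ?thesis by blast
qed

lemma uniform_map_indicator:
  assumes "uniform_map q K" "a \<in> K"
  shows "integrable unit_measure (\<lambda>x. of_bool (q x = a) :: real)"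
    and "(\<integral>x. of_bool (q x = a) \<partial>unit_measure) = (1 / real (card K) :: real)"
proof -
  let ?S = "{x \<in> {0..1}. q x = a}"
  have q: "q \<in> unit_measure \<rightarrow>\<^sub>M count_space UNIV" using assms by (simp add: uniform_map_def)
  have S: "?S \<in> sets unit_measure"
    using measurable_sets[OF q, of "{a}"] by (simp add: vimage_def Int_def conj_commute)
  have eq: "x \<in> space unit_measure \<Longrightarrow> of_bool (q x = a) = (indicator ?S x :: real)" for x
    by (auto simp: indicator_def)
  have "integrable unit_measure (indicator ?S :: real \<Rightarrow> real)"
    using S by (intro unit.integrable_const_bound[where B = 1]) auto
  then show "integrable unit_measure (\<lambda>x. of_bool (q x = a) :: real)"
    by (subst Bochner_Integration.integrable_cong[OF refl eq]) auto
  have "(\<integral>x. of_bool (q x = a) \<partial>unit_measure) = (\<integral>x. (indicator ?S x :: real) \<partial>unit_measure)"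
    by (rule Bochner_Integration.integral_cong) (rule refl, rule eq)
  also have "\<dots> = measure unit_measure ?S"
    using sets.sets_into_space[OF S] by (simp only: Bochner_Integration.integral_indicator Int_absorb2)
  also have "\<dots> = 1 / real (card K)" using assms by (simp add: uniform_map_def)
  finally show "(\<integral>x. of_bool (q x = a) \<partial>unit_measure) = 1 / real (card K)" .
qed

text \<open>For finite \<open>K\<close> the product of the two discrete spaces is again discrete, so
  \<open>f\<close> may be arbitrary.\<close>

lemma measurable_step_pair:
  assumes "uniform_map q K"
  shows "(\<lambda>(x, y). f (q x) (q y) :: real) \<in> borel_measurable (unit_measure \<Otimes>\<^sub>M unit_measure)"
proof -
  have q: "q \<in> unit_measure \<rightarrow>\<^sub>M count_space K"
    using assms by (auto simp: uniform_map_def intro!: measurable_count_space_extend[of K UNIV])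
  have "(\<lambda>p. (\<lambda>(a, b). f a b) (q (fst p), q (snd p))) \<in> borel_measurable (unit_measure \<Otimes>\<^sub>M unit_measure)"
  proof (rule measurable_compose[of _ _ "count_space (K \<times> K)"])
    have "(\<lambda>p. (q (fst p), q (snd p))) \<in> unit_measure \<Otimes>\<^sub>M unit_measure \<rightarrow>\<^sub>M count_space K \<Otimes>\<^sub>M count_space K"
      using q by measurable
    then show "(\<lambda>p. (q (fst p), q (snd p))) \<in> unit_measure \<Otimes>\<^sub>M unit_measure \<rightarrow>\<^sub>M count_space (K \<times> K)"
      using assms by (simp add: pair_measure_count_space uniform_map_def)
  qed simp
  then show ?thesis by (simp add: split_def)
qed

text \<open>\<open>f\<close> is expanded into indicators of pairs of cells, each of which has
  measure \<open>1 / real (card K) ^ 2\<close> by Fubini.\<close>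

lemma integral_step_pair:
  assumes q: "uniform_map q K"
  shows "(\<integral>(x, y). f (q x) (q y) \<partial>(unit_measure \<Otimes>\<^sub>M unit_measure))
    = (\<Sum>a\<in>K. \<Sum>b\<in>K. f a b :: real) / real (card K) ^ 2"
proof -
  have K: "finite K" and qK: "q x \<in> K" for x using q by (auto simp: uniform_map_def)
  note ind = uniform_map_indicator[OF q]
  have "integrable (unit_measure \<Otimes>\<^sub>M unit_measure) (\<lambda>p. of_bool (q (fst p) = a) * of_bool (q (snd p) = b) :: real)"
    "(\<integral>p. of_bool (q (fst p) = a) * of_bool (q (snd p) = b) \<partial>(unit_measure \<Otimes>\<^sub>M unit_measure)) = 1 / real (card K) ^ 2"
    if "a \<in> K" "b \<in> K" for a b
  proof -
    show i: "integrable (unit_measure \<Otimes>\<^sub>M unit_measure) (\<lambda>p. of_bool (q (fst p) = a) * of_bool (q (snd p) = b) :: real)"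
      using measurable_step_pair[OF q, of "\<lambda>c d. of_bool (c = a) * of_bool (d = b)"]
      by (intro unit_pair.P.integrable_const_bound[where B = 1]) (auto simp: split_def)
    show "(\<integral>p. of_bool (q (fst p) = a) * of_bool (q (snd p) = b) \<partial>(unit_measure \<Otimes>\<^sub>M unit_measure)) = 1 / real (card K) ^ 2"
      using unit_pair.integral_fst'[OF i] ind that
      by (simp add: power2_eq_square)
  qed
  note i = this
  have "(\<integral>(x, y). f (q x) (q y) \<partial>(unit_measure \<Otimes>\<^sub>M unit_measure))
    = (\<integral>p. (\<Sum>a\<in>K. \<Sum>b\<in>K. f a b * (of_bool (q (fst p) = a) * of_bool (q (snd p) = b))) \<partial>(unit_measure \<Otimes>\<^sub>M unit_measure))"
  proof (rule Bochner_Integration.integral_cong[OF refl])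
    fix p :: "real \<times> real"
    have "(\<Sum>a\<in>K. \<Sum>b\<in>K. f a b * (of_bool (q (fst p) = a) * of_bool (q (snd p) = b)))
      = (\<Sum>a\<in>K. \<Sum>b\<in>K. if q (snd p) = b then (if q (fst p) = a then f a b else 0) else 0)"
      by (intro sum.cong refl) auto
    also have "\<dots> = f (q (fst p)) (q (snd p))"
      using K qK by simp
    finally show "(case p of (x, y) \<Rightarrow> f (q x) (q y)) = (\<Sum>a\<in>K. \<Sum>b\<in>K. f a b * (of_bool (q (fst p) = a) * of_bool (q (snd p) = b)))"
      by (simp add: split_def)
  qed
  also have "\<dots> = (\<Sum>a\<in>K. \<integral>p. (\<Sum>b\<in>K. f a b * (of_bool (q (fst p) = a) * of_bool (q (snd p) = b))) \<partial>(unit_measure \<Otimes>\<^sub>M unit_measure))"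
    by (intro Bochner_Integration.integral_sum Bochner_Integration.integrable_sum integrable_mult_right i)
  also have "\<dots> = (\<Sum>a\<in>K. \<Sum>b\<in>K. \<integral>p. f a b * (of_bool (q (fst p) = a) * of_bool (q (snd p) = b)) \<partial>(unit_measure \<Otimes>\<^sub>M unit_measure))"
    by (intro sum.cong refl Bochner_Integration.integral_sum integrable_mult_right i)
  also have "\<dots> = (\<Sum>a\<in>K. \<Sum>b\<in>K. f a b * (1 / real (card K) ^ 2))"
    using i by (intro sum.cong refl) simp
  finally show ?thesis by (simp add: sum_divide_distrib)
qed

lemma integral_step_cube:
  fixes F :: "('a \<Rightarrow> 'b) \<Rightarrow> real"
  assumes q: "uniform_map q K" and V: "finite V"
  shows "(\<integral>x. F (\<lambda>i\<in>V. q (x i)) \<partial>cube_measure V) = (\<Sum>z\<in>V \<rightarrow>\<^sub>E K. F z) / real (card K) ^ card V"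
proof -
  have K: "finite K" and qK: "q x \<in> K" for x using q by (auto simp: uniform_map_def)
  note ind = uniform_map_indicator[OF q]
  \<comment> \<open>Exactly one \<open>z\<close> agrees with the cells of all coordinates, and the
    product of indicators selects it; each such product integrates factor by factor.\<close>
  let ?g = "\<lambda>x. \<Sum>z\<in>V \<rightarrow>\<^sub>E K. F z * (\<Prod>i\<in>V. of_bool (q (x i) = z i))"
  have eq: "F (\<lambda>i\<in>V. q (x i)) = ?g x" for x
  proof -
    have "?g x = (\<Sum>z\<in>V \<rightarrow>\<^sub>E K. if z = (\<lambda>i\<in>V. q (x i)) then F z else 0)"
    proof (intro sum.cong refl)
      fix z assume z: "z \<in> V \<rightarrow>\<^sub>E K"
      show "F z * (\<Prod>i\<in>V. of_bool (q (x i) = z i)) = (if z = (\<lambda>i\<in>V. q (x i)) then F z else 0)"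
      proof (cases "z = (\<lambda>i\<in>V. q (x i))")
        case True
        then show ?thesis by (simp cong: prod.cong)
      next
        case False
        then obtain i where "i \<in> V" "q (x i) \<noteq> z i"
          using PiE_ext[OF z, of "\<lambda>i\<in>V. q (x i)"] qK by force
        then have "(\<Prod>i\<in>V. of_bool (q (x i) = z i) :: real) = 0"
          using V by (intro prod_zero bexI[of _ i]) auto
        with False show ?thesis by simp
      qed
    qed
    also have "\<dots> = F (\<lambda>i\<in>V. q (x i))"
      using V K qK by (subst sum.delta) (auto intro!: finite_PiE)
    finally show ?thesis by simp
  qed
  have int: "integrable (\<Pi>\<^sub>M i\<in>V. unit_measure) (\<lambda>x. \<Prod>i\<in>V. of_bool (q (x i) = z i) :: real)"
    "(\<integral>x. (\<Prod>i\<in>V. of_bool (q (x i) = z i)) \<partial>(\<Pi>\<^sub>M i\<in>V. unit_measure)) = (1 / real (card K)) ^ card V"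
    if "z \<in> V \<rightarrow>\<^sub>E K" for z
  proof -
    have zK: "z i \<in> K" if "i \<in> V" for i using \<open>z \<in> V \<rightarrow>\<^sub>E K\<close> that by auto
    show "integrable (\<Pi>\<^sub>M i\<in>V. unit_measure) (\<lambda>x. \<Prod>i\<in>V. of_bool (q (x i) = z i) :: real)"
      using unit_prod.product_integrable_prod[OF V, of "\<lambda>i t. of_bool (q t = z i) :: real"] ind(1)[OF zK] by simp
    show "(\<integral>x. (\<Prod>i\<in>V. of_bool (q (x i) = z i)) \<partial>(\<Pi>\<^sub>M i\<in>V. unit_measure)) = (1 / real (card K)) ^ card V"
      using unit_prod.product_integral_prod[OF V, of "\<lambda>i t. of_bool (q t = z i) :: real"] ind[OF zK]
      by (simp cong: prod.cong)
  qed
  have "(\<integral>x. F (\<lambda>i\<in>V. q (x i)) \<partial>cube_measure V) = (\<integral>x. ?g x \<partial>(\<Pi>\<^sub>M i\<in>V. unit_measure))"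
    unfolding eq cube_measure_def using int
    by (intro integral_completion borel_measurable_sum borel_measurable_times borel_measurable_const) auto
  also have "\<dots> = (\<Sum>z\<in>V \<rightarrow>\<^sub>E K. F z * (1 / real (card K)) ^ card V)"
    using int by (subst Bochner_Integration.integral_sum) auto
  finally show ?thesis by (simp add: sum_divide_distrib power_divide)
qed

lemma cube_measure_space: "x \<in> space (cube_measure V) \<Longrightarrow> i \<in> V \<Longrightarrow> x i \<in> {0..1}"
  by (auto simp: cube_measure_def space_PiM)

text \<open>The kernel \<open>B\<close> is scaled into the unit interval and pulled back to a step
  graphon. Both sides are homogeneous of degree \<open>card E\<close> in the kernel, so the scaling
  cancels.\<close>

lemma sidorenko_finite:
  fixes \<Omega> :: "'b set" and B :: "'b \<Rightarrow> 'b \<Rightarrow> real"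
  assumes sid: "sidorenko V E" and st: "\<And>e. e \<in> E \<Longrightarrow> e = {s e, t e}"
    and \<Omega>: "finite \<Omega>" "\<Omega> \<noteq> {}"
    and B: "\<And>a b. a \<in> \<Omega> \<Longrightarrow> b \<in> \<Omega> \<Longrightarrow> 0 \<le> B a b" "\<And>a b. a \<in> \<Omega> \<Longrightarrow> b \<in> \<Omega> \<Longrightarrow> B a b = B b a"
  shows "((\<Sum>a\<in>\<Omega>. \<Sum>b\<in>\<Omega>. B a b) / real (card \<Omega>) ^ 2) ^ card E
        \<le> (\<Sum>z\<in>V \<rightarrow>\<^sub>E \<Omega>. \<Prod>e\<in>E. B (z (s e)) (z (t e))) / real (card \<Omega>) ^ card V"
proof -
  obtain q where q: "uniform_map q \<Omega>" using uniform_map_exists[OF \<Omega>] by blast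
  then have q\<Omega>: "q x \<in> \<Omega>" for x by (auto simp: uniform_map_def)
  have V: "finite V" and EV: "\<And>e. e \<in> E \<Longrightarrow> e \<subseteq> V"
    using sid by (auto simp: sidorenko_def simple_graph_def)
  have stV: "s e \<in> V" "t e \<in> V" if "e \<in> E" for e using st[OF that] EV[OF that] by auto
  \<comment> \<open>The sum dominates each value of \<open>B\<close>; the added 1 keeps
    \<open>C\<close> positive even when \<open>B\<close> vanishes.\<close>
  define C where "C = 1 + (\<Sum>a\<in>\<Omega>. \<Sum>b\<in>\<Omega>. B a b)"
  have C: "C > 0" unfolding C_def using B(1) by (intro add_pos_nonneg sum_nonneg) auto
  have BC: "B a b \<le> C" if "a \<in> \<Omega>" "b \<in> \<Omega>" for a b
  proof -
    have "B a b \<le> (\<Sum>b\<in>\<Omega>. B a b)" using \<Omega> B that by (intro member_le_sum) auto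
    also have "\<dots> \<le> (\<Sum>a\<in>\<Omega>. \<Sum>b\<in>\<Omega>. B a b)"
      using \<Omega> B that by (intro member_le_sum[of a \<Omega> "\<lambda>a. \<Sum>b\<in>\<Omega>. B a b"]) (auto intro: sum_nonneg)
    finally show ?thesis by (simp add: C_def)
  qed
  define W where "W x y = B (q x) (q y) / C" for x y
  have meas: "(\<lambda>(x, y). W x y) \<in> borel_measurable (unit_measure \<Otimes>\<^sub>M unit_measure)"
    unfolding W_def using measurable_step_pair[OF q, of "\<lambda>a b. B a b / C"] .
  have "symmetric_measurable W"
    unfolding symmetric_measurable_def
    by (intro conjI measurable_lebesgue_on_unit_square[OF meas]) (simp add: W_def B(2)[OF q\<Omega> q\<Omega>])
  then have "graphon W"
    unfolding graphon_def using B(1)[OF q\<Omega> q\<Omega>] BC[OF q\<Omega> q\<Omega>] C by (simp add: W_def)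
  then have "edge_density W ^ card E \<le> hom_density V E W"
    using sid by (auto simp: sidorenko_def)
  also have "edge_density W = (\<Sum>a\<in>\<Omega>. \<Sum>b\<in>\<Omega>. B a b / C) / real (card \<Omega>) ^ 2"
    unfolding edge_density_def integral_lebesgue_on_unit_square[OF meas]
    unfolding W_def by (rule integral_step_pair[OF q])
  also have "hom_density V E W = (\<integral>x. (\<lambda>z. \<Prod>e\<in>E. B (z (s e)) (z (t e)) / C) (\<lambda>i\<in>V. q (x i)) \<partial>cube_measure V)"
    unfolding hom_density_def
  proof (intro Bochner_Integration.integral_cong refl)
    fix x assume "x \<in> space (cube_measure V)"
    have "edge_weight W x e = B (q (x (s e))) (q (x (t e))) / C" if "e \<in> E" for e
      using edge_weight_eq[of W x "s e" "t e"] st[OF that] B(2)[OF q\<Omega> q\<Omega>] by (simp add: W_def)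
    then show "(\<Prod>e\<in>E. edge_weight W x e) = (\<lambda>z. \<Prod>e\<in>E. B (z (s e)) (z (t e)) / C) (\<lambda>i\<in>V. q (x i))"
      using stV by (simp cong: prod.cong)
  qed
  also have "\<dots> = (\<Sum>z\<in>V \<rightarrow>\<^sub>E \<Omega>. \<Prod>e\<in>E. B (z (s e)) (z (t e)) / C) / real (card \<Omega>) ^ card V"
    by (rule integral_step_cube[OF q V])
  also have "\<dots> = (\<Sum>z\<in>V \<rightarrow>\<^sub>E \<Omega>. \<Prod>e\<in>E. B (z (s e)) (z (t e))) / real (card \<Omega>) ^ card V / C ^ card E"
    by (simp add: prod_dividef sum_divide_distrib mult.commute)
  also have "(\<Sum>a\<in>\<Omega>. \<Sum>b\<in>\<Omega>. B a b / C) / real (card \<Omega>) ^ 2 = (\<Sum>a\<in>\<Omega>. \<Sum>b\<in>\<Omega>. B a b) / real (card \<Omega>) ^ 2 / C"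
    by (simp add: sum_divide_distrib mult.commute)
  finally show ?thesis
    using C unfolding power_divide[of _ C] divide_le_cancel by (metis zero_less_power)
qed

section \<open>Limits of kernels\<close>

text \<open>The maps \<open>s\<close> and \<open>t\<close> fix an orientation of each edge, with the
  labeled edge running from \<open>u\<close> to \<open>v\<close>; this replaces the unordered
  \<open>edge_weight\<close> by a value at an ordered pair.\<close>

locale labeled_graph =
  fixes V :: "'a set" and E :: "'a set set" and s t :: "'a set \<Rightarrow> 'a" and u v :: 'a
  assumes finite_V: "finite V"
    and edge: "\<And>e. e \<in> E \<Longrightarrow> e = {s e, t e} \<and> s e \<in> V \<and> t e \<in> V \<and> s e \<noteq> t e"
    and uv: "{u, v} \<in> E" "s {u, v} = u" "t {u, v} = v"
begin

lemma uv_V: "u \<in> V" "v \<in> V" "u \<noteq> v"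
  using edge[OF uv(1)] uv by auto

lemma finite_E: "finite E"
proof (rule finite_subset)
  show "E \<subseteq> Pow V"
  proof
    fix e assume "e \<in> E"
    then show "e \<in> Pow V" using edge[of e] by (metis PowI empty_subsetI insert_subset)
  qed
qed (use finite_V in simp)

abbreviation E' where "E' \<equiv> E - {{u, v}}"

abbreviation unlabeled where "unlabeled \<equiv> V - {u, v}"

definition weight :: "('b \<Rightarrow> 'b \<Rightarrow> real) \<Rightarrow> 'b \<Rightarrow> 'b \<Rightarrow> ('a \<Rightarrow> 'b) \<Rightarrow> real" where
  "weight W a b y = (\<Prod>e\<in>E'. W (extend V u v a b y (s e)) (extend V u v a b y (t e)))"

definition labeled_density :: "(real \<Rightarrow> real \<Rightarrow> real) \<Rightarrow> real \<Rightarrow> real \<Rightarrow> real" where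
  "labeled_density W a b = (\<integral>y. weight W a b y \<partial>cube_measure unlabeled)"

text \<open>The smoothness inequality multiplied by the edge density, which avoids dividing by a
  quantity that varies along a sequence of kernels.\<close>

definition smooth_for :: "(real \<Rightarrow> real \<Rightarrow> real) \<Rightarrow> bool" where
  "smooth_for W \<longleftrightarrow>
     integrable (lebesgue_on unit_square) (\<lambda>(x, y). W x y * ln (labeled_density W x y)) \<and>
     (\<integral>(x, y). W x y * ln (labeled_density W x y) \<partial>lebesgue_on unit_square)
       \<ge> real (card E') * (edge_density W * ln (edge_density W))"

lemma extend_unit:
  assumes "x1 \<in> {0..1}" "x2 \<in> {0..1}" "y \<in> space (cube_measure unlabeled)" "w \<in> V"
  shows "extend V u v x1 x2 y w \<in> {0..1}"
  using assms cube_measure_space[OF assms(3), of w] by (auto simp: extend_def merge_def)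

lemma restricted_density_eq:
  assumes "symmetric_measurable W" "x1 \<in> {0..1}" "x2 \<in> {0..1}"
  shows "restricted_density V E' {u, v} W (\<lambda>w. if w = u then x1 else x2) = labeled_density W x1 x2"
  unfolding restricted_density_def labeled_density_def weight_def extend_def[symmetric]
proof (intro Bochner_Integration.integral_cong prod.cong refl)
  fix y e assume y: "y \<in> space (cube_measure unlabeled)" and e: "e \<in> E'"
  let ?z = "extend V u v x1 x2 y"
  have "?z (s e) \<in> {0..1}" "?z (t e) \<in> {0..1}"
    using extend_unit[OF assms(2,3) y] e edge by auto
  then have "edge_weight W ?z {s e, t e} = W (?z (s e)) (?z (t e))"
    using assms(1) by (intro edge_weight_eq) (auto simp: symmetric_measurable_def)
  then show "edge_weight W ?z e = W (?z (s e)) (?z (t e))"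
    using edge e by auto
qed

lemma prob_space_cube: "prob_space (cube_measure unlabeled)"
proof -
  have "prob_space (\<Pi>\<^sub>M i\<in>unlabeled. unit_measure)" by (intro prob_space_PiM prob_space_unit_measure)
  then show ?thesis unfolding cube_measure_def
    by (intro prob_spaceI) (simp add: prob_space.emeasure_space_1)
qed

text \<open>Carries an almost everywhere property of pairs over to the two ends of an edge other
  than the labeled one, for almost all labels and then almost all unlabeled coordinates. With both
  ends unlabeled it is a projection of the cube; with one end labeled it is Fubini.\<close>

lemma AE_extend:
  assumes Q: "AE p in unit_measure \<Otimes>\<^sub>M unit_measure. Q (fst p) (snd p)"
    and ij: "i \<in> V" "j \<in> V" "i \<noteq> j" "{i, j} \<noteq> {u, v}"
  shows "AE p in unit_measure \<Otimes>\<^sub>M unit_measure. AE y in (\<Pi>\<^sub>M i\<in>unlabeled. unit_measure).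
    Q (extend V u v (fst p) (snd p) y i) (extend V u v (fst p) (snd p) y j)"
proof -
  let ?P = "unit_measure \<Otimes>\<^sub>M unit_measure"
  let ?Y = "\<Pi>\<^sub>M i\<in>unlabeled. unit_measure"
  \<comment> \<open>The labeled end is taken as first argument. Fubini gives the claim for label
    \<open>u\<close>, and the swap turns it into the claim for label \<open>v\<close>.\<close>
  have mixed: "AE p in ?P. AE y in ?Y.
      R (extend V u v (fst p) (snd p) y i) (extend V u v (fst p) (snd p) y j)"
    if R: "AE p in ?P. R (fst p) (snd p)" and i: "i \<in> {u, v}" and j: "j \<in> unlabeled" for R i j
  proof -
    have "AE x in unit_measure. AE z in unit_measure. R x z"
      using unit_pair.AE_pair[OF R] by simp
    moreover have "AE y in ?Y. R x (y j)" if "AE z in unit_measure. R x z" for x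
      using that j by (intro AE_PiM_component[of unlabeled "\<lambda>_. unit_measure"]) (auto intro: prob_space_unit_measure)
    ultimately have *: "AE x in unit_measure. AE y in ?Y. R x (y j)" by (auto elim: AE_mp)
    have fst: "AE p in ?P. AE y in ?Y. R (fst p) (y j)"
      by (rule AE_distrD[OF measurable_fst]) (simp only: unit.distr_pair_fst *)
    have snd: "AE p in ?P. AE y in ?Y. R (snd p) (y j)"
      using AE_unit_pair_swap[OF fst] .
    show ?thesis
    proof (cases "i = u")
      case True
      then show ?thesis using fst j by simp
    next
      case False
      then have "i = v" using i by simp
      then show ?thesis using snd j uv_V by simp
    qed
  qed
  consider "i \<in> unlabeled" "j \<in> unlabeled" | "i \<in> {u, v}" "j \<in> unlabeled" | "i \<in> unlabeled" "j \<in> {u, v}"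
    using ij by auto
  then show ?thesis
  proof cases
    case 1
    have "AE y in ?Y. Q (fst (y i, y j)) (snd (y i, y j))"
    proof (rule AE_distrD[of "\<lambda>y. (y i, y j)" ?Y ?P "\<lambda>p. Q (fst p) (snd p)"])
      show "(\<lambda>y. (y i, y j)) \<in> ?Y \<rightarrow>\<^sub>M ?P"
        using 1 by (intro measurable_Pair measurable_component_singleton)
      show "AE p in distr ?Y ?P (\<lambda>y. (y i, y j)). Q (fst p) (snd p)"
        using Q 1 ij finite_V by (subst distr_PiM_pair) auto
    qed
    then show ?thesis using 1 by simp
  next
    case 2
    show ?thesis by (rule mixed[OF Q 2])
  next
    case 3
    \<comment> \<open>Here the labeled end comes second, so \<open>mixed\<close> is applied to the
      property with its arguments exchanged.\<close>
    show ?thesis by (rule mixed[OF AE_unit_pair_swap[OF Q] 3(2,1)])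
  qed
qed

text \<open>Measurability for the product sigma-algebra passes to all sections, so every pair of
  labels is covered. For a Lebesgue measurable kernel the corresponding fact is obtained for almost
  all labels, by a limit.\<close>

lemma measurable_weight:
  assumes W: "(\<lambda>(x, y). W x y) \<in> borel_measurable (unit_measure \<Otimes>\<^sub>M unit_measure)"
    and x: "x1 \<in> {0..1}" "x2 \<in> {0..1}"
  shows "weight W x1 x2 \<in> borel_measurable (cube_measure unlabeled)"
  unfolding weight_def cube_measure_def
proof (intro measurable_completion borel_measurable_prod)
  fix e assume e: "e \<in> E'"
  let ?Y = "\<Pi>\<^sub>M i\<in>unlabeled. unit_measure"
  have comp: "(\<lambda>y. extend V u v x1 x2 y w) \<in> ?Y \<rightarrow>\<^sub>M unit_measure" if w: "w \<in> V" for w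
  proof -
    consider "w = u" | "w = v" "u \<noteq> v" | "w \<in> unlabeled" using w uv_V by auto
    then show ?thesis
      by cases (use x w in \<open>auto intro!: measurable_const measurable_component_singleton simp: space_restrict_space\<close>)
  qed
  have "(\<lambda>y. (extend V u v x1 x2 y (s e), extend V u v x1 x2 y (t e))) \<in> ?Y \<rightarrow>\<^sub>M unit_measure \<Otimes>\<^sub>M unit_measure"
    using e edge by (intro measurable_Pair comp) auto
  from measurable_compose[OF this W]
  show "(\<lambda>y. W (extend V u v x1 x2 y (s e)) (extend V u v x1 x2 y (t e))) \<in> borel_measurable ?Y"
    by simp
qed

section \<open>Bounds for positive bounded kernels\<close>

context
  fixes W :: "real \<Rightarrow> real \<Rightarrow> real" and B :: real
  assumes W: "\<And>x y. x \<in> {0..1} \<Longrightarrow> y \<in> {0..1} \<Longrightarrow> 0 < W x y \<and> W x y \<le> B"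
begin

lemma weight_bounds:
  assumes "x1 \<in> {0..1}" "x2 \<in> {0..1}" "y \<in> space (cube_measure unlabeled)"
  shows "0 < weight W x1 x2 y" "weight W x1 x2 y \<le> B ^ card E'"
proof -
  have *: "0 < W (extend V u v x1 x2 y (s e)) (extend V u v x1 x2 y (t e)) \<and>
      W (extend V u v x1 x2 y (s e)) (extend V u v x1 x2 y (t e)) \<le> B" if "e \<in> E'" for e
    using that edge by (intro W extend_unit assms) auto
  then show "0 < weight W x1 x2 y" unfolding weight_def by (intro prod_pos) auto
  have "weight W x1 x2 y \<le> (\<Prod>e\<in>E'. B)"
    unfolding weight_def using * by (intro prod_mono) (auto intro: less_imp_le)
  then show "weight W x1 x2 y \<le> B ^ card E'" by simp
qed

text \<open>The measurability assumption gives integrability of the weight; the integral of a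
  non-integrable weight would be 0 by default and positivity would fail.\<close>

lemma labeled_density_bounds:
  assumes x: "x1 \<in> {0..1}" "x2 \<in> {0..1}" and m: "weight W x1 x2 \<in> borel_measurable (cube_measure unlabeled)"
  shows "0 < labeled_density W x1 x2" "labeled_density W x1 x2 \<le> B ^ card E'"
proof -
  interpret prob_space "cube_measure unlabeled" by (rule prob_space_cube)
  have i: "integrable (cube_measure unlabeled) (weight W x1 x2)"
    using weight_bounds[OF x] m by (intro integrable_const_bound[where B = "B ^ card E'"] AE_I2) (auto simp: abs_of_pos)
  then show "0 < labeled_density W x1 x2"
    unfolding labeled_density_def using weight_bounds[OF x] by (intro expectation_greater AE_I2) auto
  show "labeled_density W x1 x2 \<le> B ^ card E'"
    unfolding labeled_density_def using i weight_bounds[OF x] by (intro integral_le_const AE_I2) auto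
qed

lemma edge_density_pos:
  assumes "(\<lambda>(x, y). W x y) \<in> borel_measurable (lebesgue_on unit_square)"
  shows "integrable (lebesgue_on unit_square) (\<lambda>(x, y). W x y)" "0 < edge_density W"
proof -
  show i: "integrable (lebesgue_on unit_square) (\<lambda>(x, y). W x y)"
    using assms W by (intro lebesgue_square.integrable_const_bound[where B = B] AE_I2) (auto simp: abs_of_pos)
  then show "0 < edge_density W"
    unfolding edge_density_def using W by (intro lebesgue_square.expectation_greater AE_I2) auto
qed

end


text \<open>For almost every pair of labels all factors of the weight converge for almost all
  unlabeled coordinates, and dominated convergence applies with the constant bound
  \<open>B ^ card E'\<close>.\<close>

lemma labeled_density_LIMSEQ:
  assumes Wn: "\<And>n x y. x \<in> {0..1} \<Longrightarrow> y \<in> {0..1} \<Longrightarrow> 0 < Wn n x y \<and> Wn n x y \<le> B"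
    and Wn_m: "\<And>n. (\<lambda>(x, y). Wn n x y) \<in> borel_measurable (unit_measure \<Otimes>\<^sub>M unit_measure)"
    and W: "\<And>x y. x \<in> {0..1} \<Longrightarrow> y \<in> {0..1} \<Longrightarrow> 0 < W x y \<and> W x y \<le> B"
    and lim: "AE p in lebesgue_on unit_square. (\<lambda>n. Wn n (fst p) (snd p)) \<longlonglongrightarrow> W (fst p) (snd p)"
  shows "AE p in lebesgue_on unit_square. 0 < labeled_density W (fst p) (snd p) \<and>
    (\<lambda>n. labeled_density (Wn n) (fst p) (snd p)) \<longlonglongrightarrow> labeled_density W (fst p) (snd p)"
proof -
  let ?P = "unit_measure \<Otimes>\<^sub>M unit_measure"
  let ?Y = "\<Pi>\<^sub>M i\<in>unlabeled. unit_measure"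
  let ?z = "\<lambda>p y. extend V u v (fst p) (snd p) y"
  let ?Q = "\<lambda>x y. (\<lambda>n. Wn n x y) \<longlonglongrightarrow> W x y"
  have "AE p in ?P. ?Q (fst p) (snd p)"
    using lim by (simp only: AE_lebesgue_on_unit_square)
  then have "AE p in ?P. AE y in ?Y. ?Q (?z p y (s e)) (?z p y (t e))" if "e \<in> E'" for e
    using that edge[of e] by (intro AE_extend) auto
  then have "AE p in ?P. AE y in ?Y. \<forall>e\<in>E'. ?Q (?z p y (s e)) (?z p y (t e))"
    using finite_E by (simp add: AE_finite_all)
  then have "AE p in lebesgue_on unit_square. AE y in ?Y. \<forall>e\<in>E'. ?Q (?z p y (s e)) (?z p y (t e))"
    by (simp only: AE_lebesgue_on_unit_square)
  then show ?thesis
  proof (rule AE_mp, intro AE_I2 impI)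
    fix p :: "real \<times> real"
    assume "p \<in> space (lebesgue_on unit_square)"
    then obtain x1 x2 where p: "p = (x1, x2)" "x1 \<in> {0..1}" "x2 \<in> {0..1}" by auto
    assume "AE y in ?Y. \<forall>e\<in>E'. ?Q (?z p y (s e)) (?z p y (t e))"
    then have "AE y in cube_measure unlabeled. \<forall>e\<in>E'. ?Q (?z p y (s e)) (?z p y (t e))"
      unfolding cube_measure_def by (rule AE_completion)
    then have AE: "AE y in cube_measure unlabeled. (\<lambda>n. weight (Wn n) x1 x2 y) \<longlonglongrightarrow> weight W x1 x2 y"
      unfolding weight_def by (rule AE_mp) (auto simp: p intro!: AE_I2 tendsto_prod)
    have Wn_w: "weight (Wn n) x1 x2 \<in> borel_measurable (cube_measure unlabeled)" for n
      by (rule measurable_weight[OF Wn_m p(2,3)])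
    interpret complete_measure "cube_measure unlabeled"
      unfolding cube_measure_def by unfold_locales
    interpret prob_space "cube_measure unlabeled" by (rule prob_space_cube)
    \<comment> \<open>\<open>W\<close> itself is not assumed measurable here; the section of its
      weight inherits measurability from the limit because the cube measure is complete.\<close>
    have W_w: "weight W x1 x2 \<in> borel_measurable (cube_measure unlabeled)"
      by (rule borel_measurable_AE_LIMSEQ[OF Wn_w AE])
    have "(\<lambda>n. labeled_density (Wn n) x1 x2) \<longlonglongrightarrow> labeled_density W x1 x2"
      unfolding labeled_density_def
    proof (rule integral_dominated_convergence[OF W_w Wn_w _ AE])
      show "integrable (cube_measure unlabeled) (\<lambda>_. B ^ card E')" by simp
      show "AE y in cube_measure unlabeled. norm (weight (Wn n) x1 x2 y) \<le> B ^ card E'" for n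
        using weight_bounds[OF Wn p(2,3)] by (intro AE_I2) (simp add: abs_of_pos)
    qed
    then show "0 < labeled_density W (fst p) (snd p) \<and>
        (\<lambda>n. labeled_density (Wn n) (fst p) (snd p)) \<longlonglongrightarrow> labeled_density W (fst p) (snd p)"
      using labeled_density_bounds(1)[OF W p(2,3) W_w] by (simp add: p)
  qed
qed

text \<open>The logarithms have no common lower bound, so dominated convergence does not apply to
  them. They are bounded above, and Fatou's lemma for \<open>W * (k - ln T)\<close> gives the
  inequality in the required direction.\<close>

lemma smooth_for_LIMSEQ:
  assumes B: "B \<ge> 1"
    and Wn: "\<And>n x y. x \<in> {0..1} \<Longrightarrow> y \<in> {0..1} \<Longrightarrow> 0 < Wn n x y \<and> Wn n x y \<le> B"
    and Wn_m: "\<And>n. (\<lambda>(x, y). Wn n x y) \<in> borel_measurable (unit_measure \<Otimes>\<^sub>M unit_measure)"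
    and W: "\<And>x y. x \<in> {0..1} \<Longrightarrow> y \<in> {0..1} \<Longrightarrow> 0 < W x y \<and> W x y \<le> B"
    and lim: "AE p in lebesgue_on unit_square. (\<lambda>n. Wn n (fst p) (snd p)) \<longlonglongrightarrow> W (fst p) (snd p)"
    and smooth: "\<And>n. smooth_for (Wn n)"
  shows "smooth_for W"
proof -
  let ?L = "lebesgue_on unit_square"
  let ?c = "real (card E')"
  \<comment> \<open>\<open>k\<close> is the logarithm of the common upper bound
    \<open>B ^ card E'\<close> for the densities, which makes every \<open>hn n\<close>
    nonnegative.\<close>
  define k where "k = ?c * ln B"
  define d where "d = edge_density W"
  define dn where "dn n = edge_density (Wn n)" for n
  define h where "h p = W (fst p) (snd p) * (k - ln (labeled_density W (fst p) (snd p)))" for p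
  define hn where "hn n p = Wn n (fst p) (snd p) * (k - ln (labeled_density (Wn n) (fst p) (snd p)))" for n p
  interpret L: complete_measure ?L by (intro complete_measure_lebesgue_on) simp
  have Wn_L: "(\<lambda>(x, y). Wn n x y) \<in> borel_measurable ?L" for n
    by (rule measurable_lebesgue_on_unit_square[OF Wn_m])
  have W_L: "(\<lambda>(x, y). W x y) \<in> borel_measurable ?L"
    using lim by (intro L.borel_measurable_AE_LIMSEQ[OF Wn_L]) (simp add: split_def)
  note Wi = edge_density_pos[OF W W_L] and Wni = edge_density_pos[OF Wn Wn_L]
  have d0: "d > 0" using Wi by (simp add: d_def)
  have dn: "dn \<longlonglongrightarrow> d"
    unfolding dn_def d_def edge_density_def
  proof (rule integral_dominated_convergence[OF W_L Wn_L])
    show "integrable ?L (\<lambda>_. B)" by simp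
    show "AE p in ?L. (\<lambda>n. case p of (x, y) \<Rightarrow> Wn n x y) \<longlonglongrightarrow> (case p of (x, y) \<Rightarrow> W x y)"
      using lim by (simp add: split_def)
    show "AE p in ?L. norm (case p of (x, y) \<Rightarrow> Wn n x y) \<le> B" for n
      using Wn by (intro AE_I2) (auto simp: abs_of_pos)
  qed
  \<comment> \<open>The smoothness inequality for \<open>Wn n\<close> becomes an upper bound for the
    integral of \<open>hn n\<close>, as required by Fatou.\<close>
  have hn_i: "integrable ?L (hn n)" and hn_le: "(\<integral>p. hn n p \<partial>?L) \<le> k * dn n - ?c * (dn n * ln (dn n))" for n
  proof -
    have eq: "hn n = (\<lambda>p. k * (case p of (x, y) \<Rightarrow> Wn n x y) - (case p of (x, y) \<Rightarrow> Wn n x y * ln (labeled_density (Wn n) x y)))"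
      by (auto simp: hn_def fun_eq_iff algebra_simps)
    have i: "integrable ?L (\<lambda>(x, y). Wn n x y * ln (labeled_density (Wn n) x y))"
      using smooth[of n] by (simp add: smooth_for_def)
    show "integrable ?L (hn n)"
      unfolding eq by (intro Bochner_Integration.integrable_diff integrable_mult_right Wni i)
    have "(\<integral>p. hn n p \<partial>?L) = k * dn n - (\<integral>(x, y). Wn n x y * ln (labeled_density (Wn n) x y) \<partial>?L)"
      unfolding eq using Wni[of n] i
      by (subst Bochner_Integration.integral_diff) (auto simp: dn_def edge_density_def)
    then show "(\<integral>p. hn n p \<partial>?L) \<le> k * dn n - ?c * (dn n * ln (dn n))"
      using smooth[of n] by (simp add: smooth_for_def dn_def)
  qed
  have hn0: "0 \<le> hn n p" if sp: "p \<in> space ?L" for n p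
  proof -
    obtain x1 x2 where p: "p = (x1, x2)" "x1 \<in> {0..1}" "x2 \<in> {0..1}" using sp by auto
    note b = labeled_density_bounds[OF Wn p(2,3) measurable_weight[OF Wn_m p(2,3)], of n]
    have "ln (labeled_density (Wn n) x1 x2) \<le> ln (B ^ card E')" using b B by simp
    also have "\<dots> = k" using B by (simp add: k_def ln_realpow)
    finally show ?thesis using Wn[OF p(2,3), of n] by (simp add: hn_def p)
  qed
  have dens_lim: "AE p in ?L. 0 < labeled_density W (fst p) (snd p) \<and>
      (\<lambda>n. labeled_density (Wn n) (fst p) (snd p)) \<longlonglongrightarrow> labeled_density W (fst p) (snd p)"
    by (rule labeled_density_LIMSEQ[OF Wn Wn_m W lim])
  have hlim: "AE p in ?L. (\<lambda>n. hn n p) \<longlonglongrightarrow> h p"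
    using dens_lim lim
    by eventually_elim (auto simp: h_def hn_def intro!: tendsto_intros)
  have h_m: "h \<in> borel_measurable ?L"
    by (rule L.borel_measurable_AE_LIMSEQ[OF borel_measurable_integrable[OF hn_i] hlim])
  have h0: "AE p in ?L. 0 \<le> h p"
    using hlim AE_space
  proof eventually_elim
    case (elim p)
    then show ?case using hn0 by (intro LIMSEQ_le_const[of "\<lambda>n. hn n p"]) auto
  qed
  define b where "b = k * d - ?c * (d * ln d)"
  have b: "(\<lambda>n. k * dn n - ?c * (dn n * ln (dn n))) \<longlonglongrightarrow> b"
    unfolding b_def using d0 by (intro tendsto_intros dn) auto
  have "0 \<le> (\<integral>p. hn n p \<partial>?L)" for n
    using hn0 by (intro integral_nonneg_AE AE_I2)
  then have "0 \<le> k * dn n - ?c * (dn n * ln (dn n))" for n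
    using hn_le[of n] order_trans by blast
  \<comment> \<open>Since \<open>ennreal\<close> sends negative reals to 0, the final bound can be
    read back as a real inequality only for nonnegative \<open>b\<close>.\<close>
  then have b0: "0 \<le> b" using b by (intro LIMSEQ_le_const[OF b]) auto
  have "(\<integral>\<^sup>+p. ennreal (h p) \<partial>?L) = (\<integral>\<^sup>+p. liminf (\<lambda>n. ennreal (hn n p)) \<partial>?L)"
  proof (rule nn_integral_cong_AE)
    show "AE p in ?L. ennreal (h p) = liminf (\<lambda>n. ennreal (hn n p))"
      using hlim
    proof eventually_elim
      case (elim p)
      then have "(\<lambda>n. ennreal (hn n p)) \<longlonglongrightarrow> ennreal (h p)" by (rule tendsto_ennrealI)
      then show ?case by (simp add: lim_imp_Liminf)
    qed
  qed
  also have "\<dots> \<le> liminf (\<lambda>n. \<integral>\<^sup>+p. ennreal (hn n p) \<partial>?L)"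
    using hn_i by (intro nn_integral_liminf) auto
  also have "\<dots> \<le> liminf (\<lambda>n. ennreal (k * dn n - ?c * (dn n * ln (dn n))))"
  proof (intro Liminf_mono always_eventually allI)
    fix n
    have "(\<integral>\<^sup>+p. ennreal (hn n p) \<partial>?L) = ennreal (\<integral>p. hn n p \<partial>?L)"
      using hn0 by (intro nn_integral_eq_integral hn_i AE_I2)
    then show "(\<integral>\<^sup>+p. ennreal (hn n p) \<partial>?L) \<le> ennreal (k * dn n - ?c * (dn n * ln (dn n)))"
      using hn_le[of n] by (simp add: ennreal_leI)
  qed
  also have "\<dots> = ennreal b"
    using tendsto_ennrealI[OF b] by (simp add: lim_imp_Liminf)
  finally have hb: "(\<integral>\<^sup>+p. ennreal (h p) \<partial>?L) \<le> ennreal b" .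
  \<comment> \<open>The finite bound from Fatou yields integrability of the limit as well as the
    estimate.\<close>
  have h_i: "integrable ?L h"
    using hb h_m h0 by (intro integrableI_nonneg) (auto intro: le_less_trans)
  have h_le: "(\<integral>p. h p \<partial>?L) \<le> b"
    using hb b0 by (simp add: nn_integral_eq_integral[OF h_i h0])
  have eq: "(\<lambda>(x, y). W x y * ln (labeled_density W x y)) = (\<lambda>p. k * (case p of (x, y) \<Rightarrow> W x y) - h p)"
    by (auto simp: h_def fun_eq_iff algebra_simps)
  show ?thesis
    unfolding smooth_for_def
  proof (intro conjI)
    show "integrable ?L (\<lambda>(x, y). W x y * ln (labeled_density W x y))"
      unfolding eq by (intro Bochner_Integration.integrable_diff integrable_mult_right Wi h_i)
    have "(\<integral>(x, y). W x y * ln (labeled_density W x y) \<partial>?L) = k * d - (\<integral>p. h p \<partial>?L)"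
      unfolding eq using Wi h_i
      by (subst Bochner_Integration.integral_diff) (auto simp: d_def edge_density_def)
    then show "?c * (edge_density W * ln (edge_density W)) \<le> (\<integral>(x, y). W x y * ln (labeled_density W x y) \<partial>?L)"
      using h_le by (simp add: b_def d_def)
  qed
qed

end

section \<open>Approximation by step kernels\<close>

lemma cell_approx:
  assumes "x \<in> {0..1}" "k > 0"
  shows "\<bar>real (cell k x) / real k - x\<bar> \<le> 1 / real k"
proof -
  have "real (cell k x) \<le> real k * x \<and> real k * x \<le> real (cell k x) + 1"
  proof (cases "Suc (cell k x) < k")
    case True
    then show ?thesis using cell_eq_iff[OF assms(1), of "cell k x" k] by simp
  next
    case False
    then have "real k = real (cell k x) + 1" using cell_less[OF assms(2), of x] by linarith
    moreover have "real k * x \<le> real k * 1" using assms by (intro mult_left_mono) auto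
    ultimately show ?thesis
      using cell_eq_iff[OF assms(1), of "cell k x" k] cell_less[OF assms(2), of x] by simp
  qed
  then have "\<bar>real (cell k x) - real k * x\<bar> \<le> 1" by linarith
  moreover have "real (cell k x) / real k - x = (real (cell k x) - real k * x) / real k"
    using assms(2) by (simp add: field_simps)
  ultimately show ?thesis using assms(2) by (simp add: divide_right_mono)
qed

lemma cell_LIMSEQ:
  assumes "x \<in> {0..1}"
  shows "(\<lambda>n. real (cell (Suc n) x) / real (Suc n)) \<longlonglongrightarrow> x"
proof (rule LIM_zero_cancel, rule Lim_null_comparison)
  show "\<forall>\<^sub>F n in sequentially. norm (real (cell (Suc n) x) / real (Suc n) - x) \<le> 1 / real (Suc n)"
    using cell_approx[OF assms, of "Suc _"] by (intro always_eventually) simp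
  show "(\<lambda>n. 1 / real (Suc n)) \<longlonglongrightarrow> 0"
    using LIMSEQ_inverse_real_of_nat by (simp add: inverse_eq_divide)
qed

section \<open>Smoothness for step, continuous and measurable kernels\<close>

context labeled_graph
begin

lemma smooth_for_step:
  fixes A :: "'b \<Rightarrow> 'b \<Rightarrow> real"
  assumes sid: "sidorenko V E" and q: "uniform_map q K" and K: "K \<noteq> {}"
    and A: "\<And>a b. a \<in> K \<Longrightarrow> b \<in> K \<Longrightarrow> 0 < A a b" "\<And>a b. a \<in> K \<Longrightarrow> b \<in> K \<Longrightarrow> A a b = A b a"
  shows "smooth_for (\<lambda>x y. A (q x) (q y))"
proof -
  let ?W = "\<lambda>x y. A (q x) (q y)"
  have fK: "finite K" and qK: "\<And>x. q x \<in> K" using q by (auto simp: uniform_map_def)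
  define n where "n = real (card K)"
  have n0: "n > 0" using K fK by (simp add: n_def card_gt_0_iff)
  define D where "D = (\<Sum>a\<in>K. \<Sum>b\<in>K. A a b)"
  have D0: "D > 0" unfolding D_def using K fK A(1) by (intro sum_pos) auto
  define T where "T a b = (\<Sum>y\<in>unlabeled \<rightarrow>\<^sub>E K. weight A a b y) / n ^ card unlabeled" for a b
  \<comment> \<open>The density of a step kernel depends on the labels only through their cells, so
    both sides become finite sums.\<close>
  have dens: "labeled_density ?W x1 x2 = T (q x1) (q x2)" for x1 x2
  proof -
    have "weight ?W x1 x2 = (\<lambda>y. weight A (q x1) (q x2) (\<lambda>i\<in>unlabeled. q (y i)))"
    proof
      fix y
      have "q (extend V u v x1 x2 y w) = extend V u v (q x1) (q x2) (\<lambda>i\<in>unlabeled. q (y i)) w" if "w \<in> V" for w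
        using that by (auto simp: extend_def merge_def)
      then show "weight ?W x1 x2 y = weight A (q x1) (q x2) (\<lambda>i\<in>unlabeled. q (y i))"
        unfolding weight_def using edge by (intro prod.cong refl) auto
    qed
    then show ?thesis
      unfolding labeled_density_def T_def n_def
      using integral_step_cube[OF q, of unlabeled "weight A (q x1) (q x2)"] finite_V by simp
  qed
  have ed: "edge_density ?W = D / n ^ 2"
    unfolding edge_density_def integral_lebesgue_on_unit_square[OF measurable_step_pair[OF q]]
      integral_step_pair[OF q] D_def n_def ..
  have eq: "(\<lambda>(x, y). ?W x y * ln (labeled_density ?W x y)) = (\<lambda>(x, y). (\<lambda>a b. A a b * ln (T a b)) (q x) (q y))"
    by (simp add: dens)
  have meas: "(\<lambda>(x, y). ?W x y * ln (labeled_density ?W x y)) \<in> borel_measurable (unit_measure \<Otimes>\<^sub>M unit_measure)"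
    unfolding eq by (rule measurable_step_pair[OF q])
  have int: "integrable (lebesgue_on unit_square) (\<lambda>(x, y). ?W x y * ln (labeled_density ?W x y))"
  proof (rule lebesgue_square.integrable_const_bound[where B = "Max ((\<lambda>(a, b). \<bar>A a b * ln (T a b)\<bar>) ` (K \<times> K))"])
    show "AE p in lebesgue_on unit_square. norm (case p of (x, y) \<Rightarrow> ?W x y * ln (labeled_density ?W x y))
        \<le> Max ((\<lambda>(a, b). \<bar>A a b * ln (T a b)\<bar>) ` (K \<times> K))"
      unfolding dens using fK qK by (intro AE_I2) (auto intro!: Max_ge)
  qed (rule measurable_lebesgue_on_unit_square[OF meas])
  have "real (card E') * ln (D / n ^ 2) \<le> (\<Sum>a\<in>K. \<Sum>b\<in>K. A a b / D * ln (T a b))"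
    unfolding D_def T_def n_def weight_def
  proof (rule smooth_finite_kernel[where s = s and t = t, OF finite_V uv_V finite_E uv])
    show "s ` E \<subseteq> V" "t ` E \<subseteq> V" using edge by auto
    show "((\<Sum>a\<in>\<Omega>. \<Sum>b\<in>\<Omega>. B a b) / real (card \<Omega>) ^ 2) ^ card E
        \<le> (\<Sum>z\<in>V \<rightarrow>\<^sub>E \<Omega>. \<Prod>e\<in>E. B (z (s e)) (z (t e))) / real (card \<Omega>) ^ card V"
      if "finite \<Omega>" "\<Omega> \<noteq> {}" "\<And>a b. a \<in> \<Omega> \<Longrightarrow> b \<in> \<Omega> \<Longrightarrow> 0 \<le> B a b"
        "\<And>a b. a \<in> \<Omega> \<Longrightarrow> b \<in> \<Omega> \<Longrightarrow> B a b = B b a" for \<Omega> :: "(nat \<Rightarrow> 'b) set" and B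
      using edge that by (intro sidorenko_finite[OF sid]) auto
  qed (use fK K A in auto)
  \<comment> \<open>Multiplying by the edge density \<open>D / n ^ 2\<close> passes from the
    normalised form to that of \<open>smooth_for\<close>.\<close>
  then have "D / n ^ 2 * (real (card E') * ln (D / n ^ 2)) \<le> D / n ^ 2 * (\<Sum>a\<in>K. \<Sum>b\<in>K. A a b / D * ln (T a b))"
    using D0 by (intro mult_left_mono) auto
  also have "\<dots> = (\<Sum>a\<in>K. \<Sum>b\<in>K. A a b * ln (T a b)) / n ^ 2"
    using D0 by (simp add: sum_distrib_left sum_divide_distrib)
  also have "\<dots> = (\<integral>(x, y). ?W x y * ln (labeled_density ?W x y) \<partial>lebesgue_on unit_square)"
    unfolding integral_lebesgue_on_unit_square[OF meas] unfolding eq n_def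
    by (rule integral_step_pair[OF q, symmetric])
  finally show ?thesis
    unfolding smooth_for_def ed using int by (simp add: mult_ac)
qed

text \<open>Sampling \<open>g\<close> at the left endpoints of the cells keeps bounds and symmetry,
  and continuity makes the samples converge pointwise. Using \<open>Suc n\<close> cells avoids an
  empty subdivision.\<close>

lemma smooth_for_continuous:
  fixes g :: "real \<times> real \<Rightarrow> real"
  assumes sid: "sidorenko V E" and g: "continuous_on UNIV g" and B: "B \<ge> 1"
    and g_bounds: "\<And>p. 0 < g p \<and> g p \<le> B" and g_sym: "\<And>x y. g (x, y) = g (y, x)"
  shows "smooth_for (\<lambda>x y. g (x, y))"
proof (rule smooth_for_LIMSEQ[OF B])
  let ?Wn = "\<lambda>n x y. (\<lambda>i j. g (real i / real (Suc n), real j / real (Suc n))) (cell (Suc n) x) (cell (Suc n) y)"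
  have q: "uniform_map (cell (Suc n)) {..<Suc n}" for n by (rule uniform_map_cell) simp
  show "(\<lambda>(x, y). ?Wn n x y) \<in> borel_measurable (unit_measure \<Otimes>\<^sub>M unit_measure)" for n
    by (rule measurable_step_pair[OF q])
  show "smooth_for (?Wn n)" for n
    by (rule smooth_for_step[OF sid q]) (auto simp: g_bounds intro: g_sym)
  show "AE p in lebesgue_on unit_square. (\<lambda>n. ?Wn n (fst p) (snd p)) \<longlonglongrightarrow> g (fst p, snd p)"
  proof (intro AE_I2)
    fix p :: "real \<times> real" assume "p \<in> space (lebesgue_on unit_square)"
    then have "fst p \<in> {0..1}" "snd p \<in> {0..1}" by auto
    then have "(\<lambda>n. (real (cell (Suc n) (fst p)) / real (Suc n), real (cell (Suc n) (snd p)) / real (Suc n)))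
        \<longlonglongrightarrow> (fst p, snd p)"
      by (intro tendsto_Pair cell_LIMSEQ)
    then show "(\<lambda>n. ?Wn n (fst p) (snd p)) \<longlonglongrightarrow> g (fst p, snd p)"
      by (rule continuous_on_tendsto_compose[OF g]) auto
  qed
qed (use g_bounds in auto)

lemma smooth_for_kernel:
  assumes sid: "sidorenko V E" and W: "bounded_positive_kernel W"
  shows "smooth_for W"
proof -
  obtain B0 where B0: "\<And>x y. x \<in> {0..1} \<Longrightarrow> y \<in> {0..1} \<Longrightarrow> 0 < W x y \<and> W x y \<le> B0"
    using W unfolding bounded_positive_kernel_def by blast
  define B where "B = max 1 B0"
  have B: "B \<ge> 1" and WB: "\<And>x y. x \<in> {0..1} \<Longrightarrow> y \<in> {0..1} \<Longrightarrow> 0 < W x y \<and> W x y \<le> B"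
    using B0 by (auto simp: B_def le_max_iff_disj)
  have W_m: "(\<lambda>(x, y). W x y) \<in> borel_measurable (lebesgue_on unit_square)"
    and W_sym: "\<And>x y. x \<in> {0..1} \<Longrightarrow> y \<in> {0..1} \<Longrightarrow> W x y = W y x"
    using W by (auto simp: bounded_positive_kernel_def symmetric_measurable_def)
  have "(\<lambda>(x, y). W x y) measurable_on unit_square"
    using W_m by (subst measurable_on_iff_borel_measurable) auto
  then obtain N g where N: "negligible N" and g: "\<And>n. continuous_on UNIV (g n)"
    and lim: "\<And>p. p \<notin> N \<Longrightarrow> (\<lambda>n. g n p) \<longlonglongrightarrow> (if p \<in> unit_square then (\<lambda>(x, y). W x y) p else 0)"
    unfolding measurable_on_def by blast
  \<comment> \<open>Averaging with the transposed function restores symmetry, the \<open>min\<close>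
    restores the upper bound, and the lower cut-off \<open>1 / real (Suc n)\<close> gives positivity
    while vanishing in the limit.\<close>
  define gs where "gs n p = max (1 / real (Suc n)) (min B ((g n p + g n (snd p, fst p)) / 2))" for n and p :: "real \<times> real"
  have gs_cont: "continuous_on UNIV (gs n)" for n
  proof -
    have "continuous_on UNIV (\<lambda>p. g n (snd p, fst p))"
      by (rule continuous_on_compose2[OF g]) (auto intro!: continuous_intros)
    then show ?thesis
      unfolding gs_def using g by (intro continuous_intros) auto
  qed
  have gs_bounds: "0 < gs n p \<and> gs n p \<le> B" for n p
  proof -
    have "1 / real (Suc n) \<le> 1" by simp
    then have "1 / real (Suc n) \<le> B" using B by linarith
    moreover have "0 < 1 / real (Suc n)" by simp
    ultimately show ?thesis unfolding gs_def by (simp only: less_max_iff_disj max.bounded_iff min.cobounded1 simp_thms)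
  qed
  have gs: "smooth_for (\<lambda>x y. gs n (x, y))" for n
  proof (rule smooth_for_continuous[OF sid gs_cont B gs_bounds])
    show "gs n (x, y) = gs n (y, x)" for x y
      by (simp add: gs_def add.commute)
  qed
  have AE_N: "AE p in lebesgue_on unit_square. p \<notin> N"
  proof -
    have "AE p in lebesgue. p \<notin> N" using N by (intro AE_not_in) (simp add: negligible_iff_null_sets)
    then show ?thesis by (auto simp: AE_restrict_space_iff)
  qed
  \<comment> \<open>The average also evaluates \<open>g\<close> at the transposed point, which must
    avoid the null set too.\<close>
  have AE_N': "AE p in lebesgue_on unit_square. (snd p, fst p) \<notin> N"
    using AE_unit_pair_swap[of "\<lambda>x y. (x, y) \<notin> N"] AE_N by (simp add: AE_lebesgue_on_unit_square)
  show ?thesis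
  proof (rule smooth_for_LIMSEQ[OF B _ _ WB _ gs])
    show "0 < gs n (x, y) \<and> gs n (x, y) \<le> B" for n x y by (rule gs_bounds)
    show "(\<lambda>(x, y). gs n (x, y)) \<in> borel_measurable (unit_measure \<Otimes>\<^sub>M unit_measure)" for n
      unfolding unit_measure_pair
      using gs_cont[of n] by (intro measurable_restrict_space1) (simp add: borel_measurable_continuous_onI)
    show "AE p in lebesgue_on unit_square. (\<lambda>n. gs n (fst p, snd p)) \<longlonglongrightarrow> W (fst p) (snd p)"
      using AE_N AE_N' AE_space
    proof eventually_elim
      case (elim p)
      then obtain x y where p: "p = (x, y)" "x \<in> {0..1}" "y \<in> {0..1}" by auto
      have "(\<lambda>n. g n (x, y)) \<longlonglongrightarrow> W x y"
        using lim[of "(x, y)"] elim p by auto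
      moreover have "(\<lambda>n. g n (y, x)) \<longlonglongrightarrow> W x y"
        using lim[of "(y, x)"] elim p W_sym[OF p(2,3)] by auto
      moreover have "(\<lambda>n. 1 / real (Suc n)) \<longlonglongrightarrow> 0"
        using LIMSEQ_inverse_real_of_nat by (simp add: inverse_eq_divide)
      \<comment> \<open>The clamping in the limit is harmless because \<open>W\<close> takes values
        in the interval from 0 to \<open>B\<close>.\<close>
      ultimately have "(\<lambda>n. gs n (x, y)) \<longlonglongrightarrow> max 0 (min B ((W x y + W x y) / 2))"
        unfolding gs_def fst_conv snd_conv by (intro tendsto_intros) auto
      also have "max 0 (min B ((W x y + W x y) / 2)) = W x y"
        using WB[OF p(2,3)] by simp
      finally show ?case by (simp add: p)
    qed
  qed
qed

end

section \<open>From the kernel inequality to smoothness of an edge\<close>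

theorem mainTheorem4:
  fixes V :: "'a set" and E :: "'a set set" and u v :: 'a
  assumes "sidorenko V E"
    and "{u, v} \<in> E"
  shows "smooth_edge V E u v"
proof -
  have V: "finite V" and E: "\<And>e. e \<in> E \<Longrightarrow> e \<subseteq> V \<and> card e = 2"
    using assms(1) by (auto simp: sidorenko_def simple_graph_def)
  \<comment> \<open>An orientation of all edges is chosen, prescribed as \<open>(u, v)\<close> on
    the labeled edge so that the locale applies.\<close>
  have "\<forall>e\<in>E. \<exists>p. e = {fst p, snd p} \<and> fst p \<noteq> snd p \<and> (e = {u, v} \<longrightarrow> p = (u, v))"
  proof
    fix e assume e: "e \<in> E"
    then obtain a b where ab: "e = {a, b}" "a \<noteq> b" using E[OF e] by (auto simp: card_2_iff)
    show "\<exists>p. e = {fst p, snd p} \<and> fst p \<noteq> snd p \<and> (e = {u, v} \<longrightarrow> p = (u, v))"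
    proof (cases "e = {u, v}")
      case True
      then have "u \<noteq> v" using E[OF e] by auto
      with True show ?thesis by (intro exI[of _ "(u, v)"]) simp
    next
      case False
      with ab show ?thesis by (intro exI[of _ "(a, b)"]) simp
    qed
  qed
  then obtain p where p: "\<And>e. e \<in> E \<Longrightarrow> e = {fst (p e), snd (p e)} \<and> fst (p e) \<noteq> snd (p e) \<and> (e = {u, v} \<longrightarrow> p e = (u, v))"
    by metis
  interpret labeled_graph V E "\<lambda>e. fst (p e)" "\<lambda>e. snd (p e)" u v
  proof
    fix e assume e: "e \<in> E"
    then have "e = {fst (p e), snd (p e)}" "fst (p e) \<noteq> snd (p e)" using p by auto
    then show "e = {fst (p e), snd (p e)} \<and> fst (p e) \<in> V \<and> snd (p e) \<in> V \<and> fst (p e) \<noteq> snd (p e)"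
      using E[OF e] by (metis insert_subset)
  qed (use V assms(2) p[OF assms(2)] in auto)
  show ?thesis
    unfolding smooth_edge_def Let_def
  proof (intro allI impI)
    fix W assume W: "bounded_positive_kernel W"
    let ?L = "lebesgue_on unit_square" and ?d = "edge_density W"
    let ?f = "\<lambda>(x1, x2). W x1 x2 / ?d * ln (restricted_density V E' {u, v} W (\<lambda>w. if w = u then x1 else x2))"
    let ?g = "\<lambda>(x1, x2). W x1 x2 * ln (labeled_density W x1 x2)"
    have sym: "symmetric_measurable W" using W by (simp add: bounded_positive_kernel_def)
    obtain C where "\<And>x y. x \<in> {0..1} \<Longrightarrow> y \<in> {0..1} \<Longrightarrow> 0 < W x y \<and> W x y \<le> C"
      using W unfolding bounded_positive_kernel_def by blast
    then have d: "?d > 0"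
      by (rule edge_density_pos) (use sym in \<open>auto simp: symmetric_measurable_def\<close>)
    have g: "integrable ?L ?g" "integral\<^sup>L ?L ?g \<ge> real (card E') * (?d * ln ?d)"
      using smooth_for_kernel[OF assms(1) W] by (auto simp: smooth_for_def)
    \<comment> \<open>On the unit square the restricted density is the oriented
      \<open>labeled_density\<close>, so only the factor \<open>1 / ?d\<close> separates the two
      integrands.\<close>
    have fg: "?f p = ?g p / ?d" if "p \<in> space ?L" for p
      using that restricted_density_eq[OF sym] by (auto simp: split_def)
    have "integrable ?L (\<lambda>p. ?g p / ?d)" using g(1) by (rule integrable_divide_zero)
    then have "integrable ?L ?f"
      by (subst Bochner_Integration.integrable_cong[OF refl fg])
    moreover have "integral\<^sup>L ?L ?f = integral\<^sup>L ?L ?g / ?d"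
      by (subst Bochner_Integration.integral_cong[OF refl fg]) (simp_all only: integral_divide_zero)
    moreover have "real (card E') * ln ?d \<le> integral\<^sup>L ?L ?g / ?d"
      using g(2) d by (simp add: le_divide_eq mult_ac)
    ultimately show "integrable ?L ?f \<and> real (card E') * ln ?d \<le> integral\<^sup>L ?L ?f" by simp
  qed
qed

end
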